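(* Let $p$ be a prime number. For any pair of real numbers $(\mu,\mu^{\times})$ satisfying $$\mu^{\times} > 5+\sqrt{17}, \qquad \frac{\mu^{\times}}{2} \leq \mu\leq \mu^{\times},$$ there exists a $p$-adic number $\xi$ such that $\mu^{\times}(\xi)=\mu^{\times}$ and $\mu(\xi)=\mu$. Consequently, the set of values $\mu^{\times}(\xi)/\mu(\xi)$, as $\xi$ ranges over the irrational $p$-adic numbers with $\mu(\xi)<\infty$, is equal to the whole interval $[1,2]$.
   Context: $|\cdot|_p$ is the $p$-adic absolute value with $|p|_p=p^{-1}$. For an irrational $p$-adic number $\xi$: $\mu(\xi)$ is the supremum of the real numbers $\mu$ for which $0 < |y\xi - x|_p \le \max\{|x|,|y|\}^{-\mu}$ has infinitely many solutions in nonzero integers $x,y$; $\mu^{\times}(\xi)$ is the supremum of the real numbers $\mu^\times$ for which $0 < |y\xi - x|_p \le (|xy|^{1/2})^{-\mu^\times}$ has infinitely many solutions in nonzero integers $x,y$. (One always has $2\le\mu(\xi)\le\mu^\times(\xi)\le 2\mu(\xi)$.) *)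

theory Defs
  imports
    Complex_Main
    "HOL-Library.Extended_Real"
    "HOL-Computational_Algebra.Primes"
    "HOL-Algebra.QuotRing"
begin

definition padic_abs :: "nat \<Rightarrow> rat \<Rightarrow> real" where
  "padic_abs p q =
     (if q = 0 then 0
      else real p powi (int (multiplicity (int p) (snd (quotient_of q)))
                        - int (multiplicity (int p) (fst (quotient_of q)))))"

text \<open>
  The field of \<open>p\<close>-adic numbers is the completion of the rationals with respect to
  \<open>padic_abs p\<close>, built as the ring of Cauchy sequences modulo the ideal of null sequences.
  The prime \<open>p\<close> is a parameter of the carrier, so an element is a coset (a set of
  rational sequences) and not an inhabitant of a separate type.
\<close>

definition padic_Cauchy :: "nat \<Rightarrow> (nat \<Rightarrow> rat) set" where
  "padic_Cauchy p = {s. \<forall>e>0. \<exists>N. \<forall>m\<ge>N. \<forall>n\<ge>N. padic_abs p (s m - s n) < e}"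

definition padic_null :: "nat \<Rightarrow> (nat \<Rightarrow> rat) set" where
  "padic_null p = {s. (\<lambda>n. padic_abs p (s n)) \<longlonglongrightarrow> 0}"

definition padic_Cauchy_ring :: "nat \<Rightarrow> (nat \<Rightarrow> rat) ring" where
  "padic_Cauchy_ring p =
     \<lparr>carrier = padic_Cauchy p,
      mult = (\<lambda>s t n. s n * t n), one = (\<lambda>_. 1),
      zero = (\<lambda>_. 0), add = (\<lambda>s t n. s n + t n)\<rparr>"

definition padic_field :: "nat \<Rightarrow> (nat \<Rightarrow> rat) set ring" where
  "padic_field p = padic_Cauchy_ring p Quot padic_null p"

definition padic_of_rat :: "nat \<Rightarrow> rat \<Rightarrow> (nat \<Rightarrow> rat) set" where
  "padic_of_rat p q = padic_null p +>\<^bsub>padic_Cauchy_ring p\<^esub> (\<lambda>_. q)"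

definition padic_norm :: "nat \<Rightarrow> (nat \<Rightarrow> rat) set \<Rightarrow> real" where
  "padic_norm p \<xi> = (THE r. \<forall>s\<in>\<xi>. (\<lambda>n. padic_abs p (s n)) \<longlonglongrightarrow> r)"

definition padic_irrationals :: "nat \<Rightarrow> (nat \<Rightarrow> rat) set set" where
  "padic_irrationals p = carrier (padic_field p) - range (padic_of_rat p)"

definition padic_linear_form :: "nat \<Rightarrow> (nat \<Rightarrow> rat) set \<Rightarrow> int \<Rightarrow> int \<Rightarrow> real" where
  "padic_linear_form p \<xi> x y =
     padic_norm p ((padic_of_rat p (of_int y) \<otimes>\<^bsub>padic_field p\<^esub> \<xi>)
                   \<ominus>\<^bsub>padic_field p\<^esub> padic_of_rat p (of_int x))"

text \<open>The exponents may be infinite, so the suprema are taken in the extended reals.\<close>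

definition irrationality_exponent :: "nat \<Rightarrow> (nat \<Rightarrow> rat) set \<Rightarrow> ereal" where
  "irrationality_exponent p \<xi> =
     Sup (ereal ` {m :: real.
       infinite {(x :: int, y :: int). x \<noteq> 0 \<and> y \<noteq> 0 \<and>
         0 < padic_linear_form p \<xi> x y \<and>
         padic_linear_form p \<xi> x y \<le> of_int (max \<bar>x\<bar> \<bar>y\<bar>) powr (- m)}})"

definition mult_irrationality_exponent :: "nat \<Rightarrow> (nat \<Rightarrow> rat) set \<Rightarrow> ereal" where
  "mult_irrationality_exponent p \<xi> =
     Sup (ereal ` {m :: real.
       infinite {(x :: int, y :: int). x \<noteq> 0 \<and> y \<noteq> 0 \<and>
         0 < padic_linear_form p \<xi> x y \<and>
         padic_linear_form p \<xi> x y \<le> sqrt (of_int \<bar>x * y\<bar>) powr (- m)}})"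

end

theory Submission
  imports Defs "HOL-Number_Theory.Cong"
begin

text \<open>
  Given \<open>\<mu>\<close> and \<open>\<mu>\<^sup>\<times>\<close>, put \<open>a = 2 \<mu> / \<mu>\<^sup>\<times> - 1\<close> and \<open>N\<^sub>k\<^sub>+\<^sub>1 = \<lceil>\<mu> N\<^sub>k\<rceil>\<close>. The Chinese remainder
  theorem yields fractions \<open>x\<^sub>k / y\<^sub>k\<close> in lowest terms with \<open>x\<^sub>k \<asymp> p^N\<^sub>k\<close>, with \<open>y\<^sub>k \<asymp> p^(a N\<^sub>k)\<close> a power of
  a prime \<open>q \<noteq> p\<close>, and such that \<open>x\<^sub>k\<^sub>+\<^sub>1 y\<^sub>k - x\<^sub>k y\<^sub>k\<^sub>+\<^sub>1\<close> has valuation exactly \<open>N\<^sub>k\<^sub>+\<^sub>1\<close>. Their limit \<open>\<xi>\<close>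
  satisfies \<open>\<bar>y\<^sub>k \<xi> - x\<^sub>k\<bar>\<^sub>p = p^(-N\<^sub>k\<^sub>+\<^sub>1)\<close>, so the pairs \<open>(x\<^sub>k, y\<^sub>k)\<close> realise both exponents. For a pair
  \<open>(u, v)\<close> of height \<open>H\<close> not proportional to any of them, \<open>v x\<^sub>k - u y\<^sub>k\<close> is a nonzero integer of size
  \<open>O(H p^N\<^sub>k)\<close>, hence not too small \<open>p\<close>-adically; choosing the first \<open>k\<close> with \<open>H \<lless> p^(N\<^sub>k\<^sub>+\<^sub>1 - N\<^sub>k)\<close>
  gives \<open>\<bar>v \<xi> - u\<bar>\<^sub>p \<ggreater> H^(-3)\<close>, which is harmless because \<open>\<mu> \<ge> \<mu>\<^sup>\<times> / 2 \<ge> 3\<close>.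

  The bounds on the ratio come from \<open>max \<bar>x\<bar> \<bar>y\<bar> \<le> \<bar>x y\<bar> \<le> (max \<bar>x\<bar> \<bar>y\<bar>)^2\<close>.
\<close>

section \<open>The p-adic absolute value on the rationals\<close>

locale padic_prime =
  fixes p :: nat
  assumes prime_p: "prime p"
begin

lemma p_gt_1: "real p > 1"
  using prime_gt_1_nat[OF prime_p] by simp

lemma prime_int_p: "prime (int p)"
  using prime_p by simp

lemma multiplicity_mult_int:
  fixes a b :: int
  assumes "a \<noteq> 0" "b \<noteq> 0"
  shows "multiplicity (int p) (a * b) = multiplicity (int p) a + multiplicity (int p) b"
  using assms prime_int_p by (simp add: prime_elem_multiplicity_mult_distrib)

text \<open>\<open>padic_abs\<close> is defined through the reduced fraction. Cross-multiplying two
  fractions for the same rational shows that the difference of valuations does not depend on the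
  fraction chosen, so reduction can be forgotten from here on.\<close>

lemma padic_abs_divide_int:
  fixes a b :: int
  assumes "a \<noteq> 0" "b \<noteq> 0"
  shows "padic_abs p (of_int a / of_int b)
           = real p powi (int (multiplicity (int p) b) - int (multiplicity (int p) a))"
proof -
  define q :: rat where "q = of_int a / of_int b"
  obtain c d where cd: "quotient_of q = (c, d)" by force
  have d: "d > 0" using quotient_of_denom_pos[OF cd] .
  have q: "q = of_int c / of_int d" using quotient_of_div[OF cd] .
  have q0: "q \<noteq> 0" using assms by (simp add: q_def)
  hence c: "c \<noteq> 0" using q by auto
  have "(of_int (a * d) :: rat) = of_int (c * b)"
    using q assms d unfolding q_def by (simp add: field_simps)
  hence "a * d = c * b" by (simp only: of_int_eq_iff)
  hence "multiplicity (int p) (a * d) = multiplicity (int p) (c * b)" by simp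
  hence "multiplicity (int p) a + multiplicity (int p) d
           = multiplicity (int p) c + multiplicity (int p) b"
    using assms c d by (simp add: multiplicity_mult_int)
  hence "int (multiplicity (int p) d) - int (multiplicity (int p) c)
           = int (multiplicity (int p) b) - int (multiplicity (int p) a)"
    by linarith
  thus ?thesis
    using q0 unfolding padic_abs_def q_def[symmetric] cd by simp
qed

lemma padic_abs_0 [simp]: "padic_abs p 0 = 0"
  by (simp add: padic_abs_def)

lemma padic_abs_pos: "q \<noteq> 0 \<Longrightarrow> padic_abs p q > 0"
  using p_gt_1 by (simp add: padic_abs_def)

lemma padic_abs_nonneg: "padic_abs p q \<ge> 0"
  by (cases "q = 0") (auto intro: less_imp_le padic_abs_pos)

lemma rat_fraction_cases:
  fixes q :: rat
  obtains "q = 0" | a b :: int where "a \<noteq> 0" "b \<noteq> 0" "q = of_int a / of_int b"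
proof (cases "q = 0")
  case False
  obtain c d where cd: "quotient_of q = (c, d)" by force
  have "d > 0" using quotient_of_denom_pos[OF cd] .
  moreover have "q = of_int c / of_int d" using quotient_of_div[OF cd] .
  ultimately show ?thesis using False that(2)[of c d] by auto
qed (use that in blast)

lemma padic_abs_mult: "padic_abs p (q * r) = padic_abs p q * padic_abs p r"
proof (cases "q = 0 \<or> r = 0")
  case False
  obtain a b where q: "a \<noteq> 0" "b \<noteq> 0" "q = of_int a / of_int b"
    by (rule rat_fraction_cases[of q]) (use False in auto)
  obtain c d where r: "c \<noteq> 0" "d \<noteq> 0" "r = of_int c / of_int d"
    by (rule rat_fraction_cases[of r]) (use False in auto)
  have "q * r = of_int (a * c) / of_int (b * d)" by (simp add: q r)
  hence "padic_abs p (q * r) = real p powi (int (multiplicity (int p) (b * d))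
      - int (multiplicity (int p) (a * c)))"
    using padic_abs_divide_int[of "a * c" "b * d"] q r by simp
  also have "\<dots> = padic_abs p q * padic_abs p r"
    unfolding q(3) r(3) padic_abs_divide_int[OF q(1,2)] padic_abs_divide_int[OF r(1,2)]
    using p_gt_1 q r
    by (simp add: multiplicity_mult_int power_int_add[symmetric] algebra_simps)
  finally show ?thesis .
qed auto

lemma padic_abs_of_int:
  assumes "a \<noteq> 0"
  shows "padic_abs p (of_int a) = 1 / real p ^ multiplicity (int p) a"
  using padic_abs_divide_int[OF assms, of 1]
  by (simp add: power_int_minus divide_inverse)

lemma padic_abs_of_int_le_1: "padic_abs p (of_int a) \<le> 1"
  using p_gt_1 by (cases "a = 0") (auto simp: padic_abs_of_int)

lemma padic_abs_minus [simp]: "padic_abs p (- q) = padic_abs p q"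
proof -
  have "padic_abs p (-1) = 1"
    using padic_abs_of_int[of "-1"] by (simp add: multiplicity_unit_right)
  thus ?thesis using padic_abs_mult[of "-1" q] by simp
qed

lemma padic_abs_diff_commute: "padic_abs p (q - r) = padic_abs p (r - q)"
  using padic_abs_minus[of "q - r"] by simp

lemma padic_abs_of_int_le_power_iff:
  assumes "a \<noteq> 0"
  shows "padic_abs p (of_int a) \<le> 1 / real p ^ n \<longleftrightarrow> int p ^ n dvd a"
proof -
  have "int p ^ n dvd a \<longleftrightarrow> n \<le> multiplicity (int p) a"
    using assms prime_int_p p_gt_1
    by (intro power_dvd_iff_le_multiplicity) (auto simp: not_prime_unit)
  thus ?thesis using p_gt_1 assms by (simp add: padic_abs_of_int field_simps)
qed

lemma padic_abs_of_int_le_power: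
  assumes "int p ^ n dvd a"
  shows "padic_abs p (of_int a) \<le> 1 / real p ^ n"
  using assms padic_abs_of_int_le_power_iff[of a n] p_gt_1 by (cases "a = 0") auto

text \<open>Liouville-type inequality: a power of \<open>p\<close> dividing a nonzero integer cannot
  exceed its size. The lower bounds for linear forms below rest on it.\<close>

lemma padic_abs_of_int_ge:
  assumes "a \<noteq> 0"
  shows "padic_abs p (of_int a) \<ge> 1 / of_int \<bar>a\<bar>"
proof -
  have "int p ^ multiplicity (int p) a \<le> \<bar>a\<bar>"
    using multiplicity_dvd[of "int p" a] assms by (simp add: zdvd_imp_le)
  hence "(of_int (int p ^ multiplicity (int p) a) :: real) \<le> of_int \<bar>a\<bar>"
    by (simp only: of_int_le_iff)
  hence "real p ^ multiplicity (int p) a \<le> of_int \<bar>a\<bar>" by simp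
  thus ?thesis using assms p_gt_1 unfolding padic_abs_of_int[OF assms]
    by (intro divide_left_mono) auto
qed

lemma padic_abs_of_int_eq_1:
  assumes "\<not> int p dvd a"
  shows "padic_abs p (of_int a) = 1"
proof -
  have "a \<noteq> 0" using assms by auto
  thus ?thesis using assms by (simp add: padic_abs_of_int not_dvd_imp_multiplicity_0)
qed

lemma padic_abs_p_power: "padic_abs p (of_int (int p ^ n)) = 1 / real p ^ n"
  using padic_abs_of_int[of "int p ^ n"] p_gt_1 prime_int_p
  by (simp add: multiplicity_same_power not_prime_unit)

text \<open>The ultrametric inequality is first proved for integers, where the power of
  \<open>p\<close> in the summand of larger absolute value divides both summands. A common
  denominator then gives the rational case.\<close>

lemma padic_abs_add_le: "padic_abs p (q + r) \<le> max (padic_abs p q) (padic_abs p r)"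
proof -
  have int: "padic_abs p (of_int (a + b)) \<le> padic_abs p (of_int a)"
    if "a \<noteq> 0" "padic_abs p (of_int b) \<le> padic_abs p (of_int a)" for a b
  proof -
    let ?m = "multiplicity (int p) a"
    have "int p ^ ?m dvd b"
    proof (cases "b = 0")
      case False
      thus ?thesis using that padic_abs_of_int_le_power_iff[OF False] padic_abs_of_int[OF \<open>a \<noteq> 0\<close>]
        by simp
    qed auto
    hence "int p ^ ?m dvd a + b" by (simp add: multiplicity_dvd)
    from padic_abs_of_int_le_power[OF this] show ?thesis
      using padic_abs_of_int[OF \<open>a \<noteq> 0\<close>] by simp
  qed
  have le: "padic_abs p (of_int (a + b)) \<le> max (padic_abs p (of_int a)) (padic_abs p (of_int b))"
    for a b
  proof (cases "padic_abs p (of_int b) \<le> padic_abs p (of_int a)")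
    case True
    show ?thesis
    proof (cases "a = 0")
      case True
      then show ?thesis by simp
    next
      case False
      then show ?thesis using int[OF False True] by simp
    qed
  next
    case False
    hence "b \<noteq> 0" using padic_abs_nonneg[of "of_int a"] by auto
    from int[OF this, of a] show ?thesis using False by (simp add: add.commute)
  qed
  have frac: "\<exists>a b. b \<noteq> 0 \<and> q = of_int a / of_int b" for q :: rat
  proof (rule rat_fraction_cases[of q])
    assume "q = 0"
    hence "q = of_int 0 / of_int 1" by simp
    thus ?thesis by (intro exI[of _ 0] exI[of _ 1]) simp
  qed blast
  obtain a b where q: "b \<noteq> 0" "q = of_int a / of_int b" using frac by blast
  obtain c d where r: "d \<noteq> 0" "r = of_int c / of_int d" using frac by blast
  \<comment> \<open>Both rationals are integer multiples of \<open>u\<close>, and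
    \<open>padic_abs p u\<close> factors out of the inequality.\<close>
  define u :: rat where "u = 1 / of_int (b * d)"
  have qr: "q = u * of_int (a * d)" "r = u * of_int (c * b)"
    using q r by (simp_all add: u_def field_simps)
  have sum: "q + r = u * of_int (a * d + c * b)" unfolding qr by (simp add: algebra_simps)
  have "padic_abs p u * padic_abs p (of_int (a * d + c * b))
      \<le> padic_abs p u * max (padic_abs p (of_int (a * d))) (padic_abs p (of_int (c * b)))"
    by (rule mult_left_mono[OF le padic_abs_nonneg])
  thus ?thesis
    unfolding sum unfolding qr padic_abs_mult
    using padic_abs_nonneg[of u] by (simp only: max_mult_distrib_left if_True)
qed

lemma padic_abs_diff_le: "padic_abs p (q - r) \<le> max (padic_abs p q) (padic_abs p r)"
  using padic_abs_add_le[of q "- r"] by simp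

lemma padic_abs_triangle: "padic_abs p (q + r) \<le> padic_abs p q + padic_abs p r"
  using padic_abs_add_le[of q r] padic_abs_nonneg[of q] padic_abs_nonneg[of r] by linarith

lemma padic_abs_diff_triangle: "\<bar>padic_abs p q - padic_abs p r\<bar> \<le> padic_abs p (q - r)"
  using padic_abs_triangle[of "q - r" r] padic_abs_triangle[of "r - q" q]
    padic_abs_diff_commute[of q r] by simp

text \<open>Isosceles triangle principle: a perturbation strictly smaller than \<open>r\<close>
  leaves the absolute value unchanged. It yields exact distances, not just upper bounds.\<close>

lemma padic_abs_eq_of_dist_less:
  assumes "padic_abs p (q - r) < padic_abs p r"
  shows "padic_abs p q = padic_abs p r"
  using assms padic_abs_add_le[of "q - r" r] padic_abs_add_le[of "r - q" q]
    padic_abs_diff_commute[of q r] by simp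

section \<open>The p-adic field as a quotient\<close>

lemma padic_CauchyI:
  assumes "\<And>e. e > 0 \<Longrightarrow> \<exists>N. \<forall>m\<ge>N. \<forall>n\<ge>N. padic_abs p (s m - s n) < e"
  shows "s \<in> padic_Cauchy p"
  using assms by (auto simp: padic_Cauchy_def)

lemma padic_CauchyD:
  assumes "s \<in> padic_Cauchy p" "e > 0"
  shows "\<exists>N. \<forall>m\<ge>N. \<forall>n\<ge>N. padic_abs p (s m - s n) < e"
  using assms by (auto simp: padic_Cauchy_def)

lemma padic_Cauchy_const: "(\<lambda>_. q) \<in> padic_Cauchy p"
  by (auto simp: padic_Cauchy_def)

lemma padic_Cauchy_uminus: "s \<in> padic_Cauchy p \<Longrightarrow> (\<lambda>n. - s n) \<in> padic_Cauchy p"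
proof -
  have "padic_abs p (- s m - - s n) = padic_abs p (s m - s n)" for m n
    using padic_abs_minus[of "s m - s n"] by (simp add: algebra_simps)
  thus "s \<in> padic_Cauchy p \<Longrightarrow> ?thesis" by (simp add: padic_Cauchy_def)
qed

lemma padic_Cauchy_add:
  assumes "s \<in> padic_Cauchy p" "t \<in> padic_Cauchy p"
  shows "(\<lambda>n. s n + t n) \<in> padic_Cauchy p"
proof (rule padic_CauchyI)
  fix e :: real assume "e > 0"
  obtain M where M: "padic_abs p (s m - s n) < e" if "m \<ge> M" "n \<ge> M" for m n
    using padic_CauchyD[OF assms(1) \<open>e > 0\<close>] by blast
  obtain N where N: "padic_abs p (t m - t n) < e" if "m \<ge> N" "n \<ge> N" for m n
    using padic_CauchyD[OF assms(2) \<open>e > 0\<close>] by blast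
  show "\<exists>N. \<forall>m\<ge>N. \<forall>n\<ge>N. padic_abs p (s m + t m - (s n + t n)) < e"
  proof (intro exI[of _ "max M N"] allI impI)
    fix m n assume "max M N \<le> m" "max M N \<le> n"
    thus "padic_abs p (s m + t m - (s n + t n)) < e"
      using M[of m n] N[of m n] padic_abs_add_le[of "s m - s n" "t m - t n"]
      by (simp add: algebra_simps)
  qed
qed

text \<open>By the reverse triangle inequality the absolute values form a real Cauchy sequence. This
  gives both the existence of the norm and the boundedness needed for products.\<close>

lemma padic_Cauchy_convergent:
  assumes "s \<in> padic_Cauchy p"
  shows "convergent (\<lambda>n. padic_abs p (s n))"
proof -
  have "Cauchy (\<lambda>n. padic_abs p (s n))"
  proof (rule CauchyI)
    fix e :: real assume "0 < e"
    then obtain N where "\<forall>m\<ge>N. \<forall>n\<ge>N. padic_abs p (s m - s n) < e"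
      using padic_CauchyD[OF assms] by blast
    thus "\<exists>M. \<forall>m\<ge>M. \<forall>n\<ge>M. norm (padic_abs p (s m) - padic_abs p (s n)) < e"
      using padic_abs_diff_triangle by (metis order.strict_trans1 real_norm_def)
  qed
  thus ?thesis by (simp add: Cauchy_convergent_iff)
qed

lemma padic_Cauchy_bounded:
  assumes "s \<in> padic_Cauchy p"
  shows "\<exists>B>0. \<forall>n. padic_abs p (s n) \<le> B"
proof -
  have "Bseq (\<lambda>n. padic_abs p (s n))"
    using padic_Cauchy_convergent[OF assms] by (rule convergent_imp_Bseq)
  thus ?thesis using padic_abs_nonneg by (auto elim!: BseqE)
qed

lemma padic_Cauchy_mult:
  assumes "s \<in> padic_Cauchy p" "t \<in> padic_Cauchy p"
  shows "(\<lambda>n. s n * t n) \<in> padic_Cauchy p"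
proof (rule padic_CauchyI)
  fix e :: real assume "e > 0"
  obtain B where B: "B > 0" "\<And>n. padic_abs p (s n) \<le> B" using padic_Cauchy_bounded[OF assms(1)] by blast
  obtain C where C: "C > 0" "\<And>n. padic_abs p (t n) \<le> C" using padic_Cauchy_bounded[OF assms(2)] by blast
  obtain M where M: "padic_abs p (s m - s n) < e / C" if "m \<ge> M" "n \<ge> M" for m n
    using padic_CauchyD[OF assms(1), of "e / C"] C \<open>e > 0\<close> by auto
  obtain N where N: "padic_abs p (t m - t n) < e / B" if "m \<ge> N" "n \<ge> N" for m n
    using padic_CauchyD[OF assms(2), of "e / B"] B \<open>e > 0\<close> by auto
  show "\<exists>N. \<forall>m\<ge>N. \<forall>n\<ge>N. padic_abs p (s m * t m - s n * t n) < e"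
  proof (intro exI[of _ "max M N"] allI impI)
    fix m n assume mn: "max M N \<le> m" "max M N \<le> n"
    have eq: "s m * t m - s n * t n = (s m - s n) * t m + s n * (t m - t n)"
      by (simp add: algebra_simps)
    have "padic_abs p ((s m - s n) * t m) \<le> padic_abs p (s m - s n) * C"
      using C padic_abs_nonneg by (simp add: padic_abs_mult mult_left_mono)
    also have "\<dots> < e" using M[of m n] mn C by (simp add: field_simps)
    finally have 1: "padic_abs p ((s m - s n) * t m) < e" .
    have "padic_abs p (s n * (t m - t n)) \<le> B * padic_abs p (t m - t n)"
      using B padic_abs_nonneg by (simp add: padic_abs_mult mult_right_mono)
    also have "\<dots> < e" using N[of m n] mn B by (simp add: field_simps)
    finally have 2: "padic_abs p (s n * (t m - t n)) < e" .
    show "padic_abs p (s m * t m - s n * t n) < e"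
      unfolding eq using 1 2 padic_abs_add_le[of "(s m - s n) * t m" "s n * (t m - t n)"] by simp
  qed
qed

lemma padic_Cauchy_ring_cring: "cring (padic_Cauchy_ring p)"
proof (rule cringI)
  show "abelian_group (padic_Cauchy_ring p)"
  proof (rule abelian_groupI)
    fix s assume "s \<in> carrier (padic_Cauchy_ring p)"
    thus "\<exists>t\<in>carrier (padic_Cauchy_ring p).
        t \<oplus>\<^bsub>padic_Cauchy_ring p\<^esub> s = \<zero>\<^bsub>padic_Cauchy_ring p\<^esub>"
      by (intro bexI[of _ "\<lambda>n. - s n"]) (simp_all add: padic_Cauchy_ring_def padic_Cauchy_uminus)
  qed (simp_all add: padic_Cauchy_ring_def padic_Cauchy_add padic_Cauchy_const algebra_simps)
  show "comm_monoid (padic_Cauchy_ring p)"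
    by (rule comm_monoidI)
      (simp_all add: padic_Cauchy_ring_def padic_Cauchy_mult padic_Cauchy_const algebra_simps)
qed (simp_all add: padic_Cauchy_ring_def algebra_simps)

lemma padic_Cauchy_ring_uminus:
  assumes "s \<in> padic_Cauchy p"
  shows "\<ominus>\<^bsub>padic_Cauchy_ring p\<^esub> s = (\<lambda>n. - s n)"
proof -
  interpret cring "padic_Cauchy_ring p" by (rule padic_Cauchy_ring_cring)
  show ?thesis
    by (rule minus_equality)
      (use assms in \<open>simp_all add: padic_Cauchy_ring_def padic_Cauchy_uminus\<close>)
qed

lemma padic_null_subset: "padic_null p \<subseteq> padic_Cauchy p"
proof
  fix s assume s: "s \<in> padic_null p"
  show "s \<in> padic_Cauchy p"
  proof (rule padic_CauchyI)
    fix e :: real assume "e > 0"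
    with s obtain N where N: "\<And>n. n \<ge> N \<Longrightarrow> padic_abs p (s n) < e"
      unfolding padic_null_def LIMSEQ_iff by fastforce
    show "\<exists>N. \<forall>m\<ge>N. \<forall>n\<ge>N. padic_abs p (s m - s n) < e"
    proof (intro exI[of _ N] allI impI)
      fix m n assume "N \<le> m" "N \<le> n"
      thus "padic_abs p (s m - s n) < e"
        using N[of m] N[of n] padic_abs_diff_le[of "s m" "s n"] by simp
    qed
  qed
qed

lemma padic_null_add:
  assumes "s \<in> padic_null p" "t \<in> padic_null p"
  shows "(\<lambda>n. s n + t n) \<in> padic_null p"
proof -
  have lim: "(\<lambda>n. padic_abs p (s n) + padic_abs p (t n)) \<longlonglongrightarrow> 0"
    using assms tendsto_add[of "\<lambda>n. padic_abs p (s n)" 0 sequentially "\<lambda>n. padic_abs p (t n)" 0]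
    by (simp add: padic_null_def)
  have "norm (padic_abs p (s n + t n)) \<le> norm (padic_abs p (s n) + padic_abs p (t n)) * 1" for n
    using padic_abs_triangle[of "s n" "t n"] padic_abs_nonneg by simp
  hence "(\<lambda>n. padic_abs p (s n + t n)) \<longlonglongrightarrow> 0"
    by (intro tendsto_0_le[OF lim] always_eventually allI)
  thus ?thesis by (simp add: padic_null_def)
qed

lemma padic_null_mult:
  assumes "s \<in> padic_null p" "t \<in> padic_Cauchy p"
  shows "(\<lambda>n. t n * s n) \<in> padic_null p"
proof -
  obtain B where B: "B > 0" "\<And>n. padic_abs p (t n) \<le> B"
    using padic_Cauchy_bounded[OF assms(2)] by blast
  have lim: "(\<lambda>n. padic_abs p (s n)) \<longlonglongrightarrow> 0"
    using assms(1) by (simp add: padic_null_def)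
  have "norm (padic_abs p (t n * s n)) \<le> norm (padic_abs p (s n)) * B" for n
    using mult_right_mono[OF B(2), of "padic_abs p (s n)" n] padic_abs_nonneg
    by (simp add: padic_abs_mult mult.commute)
  hence "(\<lambda>n. padic_abs p (t n * s n)) \<longlonglongrightarrow> 0"
    by (intro tendsto_0_le[OF lim] always_eventually allI)
  thus ?thesis by (simp add: padic_null_def)
qed

lemma padic_null_ideal: "ideal (padic_null p) (padic_Cauchy_ring p)"
proof (rule idealI)
  interpret cring "padic_Cauchy_ring p" by (rule padic_Cauchy_ring_cring)
  show "ring (padic_Cauchy_ring p)" by (rule ring_axioms)
  show "subgroup (padic_null p) (add_monoid (padic_Cauchy_ring p))"
  proof (rule add.subgroupI)
    show "padic_null p \<subseteq> carrier (padic_Cauchy_ring p)"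
      using padic_null_subset by (simp add: padic_Cauchy_ring_def)
    show "padic_null p \<noteq> {}"
      by (auto intro!: exI[of _ "\<lambda>_. 0"] simp: padic_null_def)
    show "\<ominus>\<^bsub>padic_Cauchy_ring p\<^esub> s \<in> padic_null p" if "s \<in> padic_null p" for s
      using that padic_null_subset
      by (subst padic_Cauchy_ring_uminus) (auto simp: padic_null_def)
  next
    fix s t assume "s \<in> padic_null p" "t \<in> padic_null p"
    thus "s \<oplus>\<^bsub>padic_Cauchy_ring p\<^esub> t \<in> padic_null p"
      by (simp add: padic_Cauchy_ring_def padic_null_add)
  qed
next
  fix s t assume st: "s \<in> padic_null p" "t \<in> carrier (padic_Cauchy_ring p)"
  thus "t \<otimes>\<^bsub>padic_Cauchy_ring p\<^esub> s \<in> padic_null p"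
    by (simp add: padic_Cauchy_ring_def padic_null_mult)
  show "s \<otimes>\<^bsub>padic_Cauchy_ring p\<^esub> t \<in> padic_null p"
    using padic_null_mult[of s t] st by (simp add: padic_Cauchy_ring_def mult.commute)
qed

abbreviation padic_class :: "(nat \<Rightarrow> rat) \<Rightarrow> (nat \<Rightarrow> rat) set" where
  "padic_class s \<equiv> padic_null p +>\<^bsub>padic_Cauchy_ring p\<^esub> s"

lemma padic_class_eq: "padic_class s = {\<lambda>n. z n + s n | z. z \<in> padic_null p}"
  by (auto simp: a_r_coset_def' padic_Cauchy_ring_def)

lemma padic_class_eq_iff:
  assumes "s \<in> padic_Cauchy p" "t \<in> padic_Cauchy p"
  shows "padic_class s = padic_class t \<longleftrightarrow> (\<lambda>n. padic_abs p (s n - t n)) \<longlonglongrightarrow> 0"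
proof -
  interpret I: ideal "padic_null p" "padic_Cauchy_ring p" by (rule padic_null_ideal)
  have carr: "s \<in> carrier (padic_Cauchy_ring p)" "t \<in> carrier (padic_Cauchy_ring p)"
    using assms by (simp_all add: padic_Cauchy_ring_def)
  have "padic_class s = padic_class t \<longleftrightarrow> s \<in> padic_class t"
    using I.a_repr_independence[OF _ carr(2) I.is_additive_subgroup[THEN additive_subgroup.a_subgroup]]
      I.a_rcos_self[OF carr(1)] by metis
  also have "\<dots> \<longleftrightarrow> (\<lambda>n. s n - t n) \<in> padic_null p"
  proof
    assume "(\<lambda>n. s n - t n) \<in> padic_null p"
    thus "s \<in> padic_class t"
      unfolding padic_class_eq by (intro CollectI exI[of _ "\<lambda>n. s n - t n"]) auto
  qed (auto simp: padic_class_eq)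
  finally show ?thesis by (simp add: padic_null_def)
qed

lemma carrier_padic_field: "carrier (padic_field p) = padic_class ` padic_Cauchy p"
  by (auto simp: padic_field_def FactRing_def A_RCOSETS_def' padic_Cauchy_ring_def)

text \<open>Replaces the definite description in \<open>padic_norm\<close> by a limit along one
  representative. Representatives of a coset differ by a null sequence, so their absolute values
  share one limit.\<close>

lemma padic_norm_class:
  assumes "s \<in> padic_Cauchy p"
  shows "(\<lambda>n. padic_abs p (s n)) \<longlonglongrightarrow> padic_norm p (padic_class s)"
proof -
  obtain r where r: "(\<lambda>n. padic_abs p (s n)) \<longlonglongrightarrow> r"
    using padic_Cauchy_convergent[OF assms] by (auto simp: convergent_def)
  have "(\<lambda>n. padic_abs p (t n)) \<longlonglongrightarrow> r" if "t \<in> padic_class s" for t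
  proof -
    from that obtain z where z: "z \<in> padic_null p" "t = (\<lambda>n. z n + s n)"
      by (auto simp: padic_class_eq)
    have "(\<lambda>n. padic_abs p (t n) - padic_abs p (s n)) \<longlonglongrightarrow> 0"
    proof (rule tendsto_0_le)
      show "(\<lambda>n. padic_abs p (z n)) \<longlonglongrightarrow> 0" using z by (simp add: padic_null_def)
      have "\<bar>padic_abs p (t n) - padic_abs p (s n)\<bar> \<le> padic_abs p (z n)" for n
        using padic_abs_diff_triangle[of "t n" "s n"] z(2) by simp
      thus "\<forall>\<^sub>F n in sequentially.
          norm (padic_abs p (t n) - padic_abs p (s n)) \<le> norm (padic_abs p (z n)) * 1"
        by (simp add: padic_abs_nonneg)
    qed
    from tendsto_add[OF this r] show ?thesis by simp
  qed
  moreover have "s \<in> padic_class s"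
    unfolding padic_class_eq by (intro CollectI exI[of _ "\<lambda>_. 0"]) (auto simp: padic_null_def)
  ultimately have "padic_norm p (padic_class s) = r"
    unfolding padic_norm_def by (intro the_equality) (auto intro: LIMSEQ_unique)
  thus ?thesis using r by simp
qed

text \<open>The coset map is a ring homomorphism, so the linear form is the class of a termwise
  expression. Later arguments work with rational absolute values and pass to the limit, without
  touching the quotient ring.\<close>

lemma padic_linear_form_tendsto:
  assumes "s \<in> padic_Cauchy p"
  shows "(\<lambda>n. padic_abs p (of_int y * s n - of_int x))
           \<longlonglongrightarrow> padic_linear_form p (padic_class s) x y"
proof -
  interpret I: ideal "padic_null p" "padic_Cauchy_ring p" by (rule padic_null_ideal)
  interpret h: ring_hom_cring "padic_Cauchy_ring p" "padic_field p" padic_class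
    unfolding padic_field_def by (rule I.rcos_ring_hom_cring[OF padic_Cauchy_ring_cring])
  let ?y = "\<lambda>_ :: nat. of_int y :: rat" and ?x = "\<lambda>_ :: nat. of_int x :: rat"
  have carr: "t \<in> carrier (padic_Cauchy_ring p) \<longleftrightarrow> t \<in> padic_Cauchy p" for t
    by (simp add: padic_Cauchy_ring_def)
  have x: "?x \<in> padic_Cauchy p" and y: "?y \<in> padic_Cauchy p" by (rule padic_Cauchy_const)+
  define t where "t = (?y \<otimes>\<^bsub>padic_Cauchy_ring p\<^esub> s) \<ominus>\<^bsub>padic_Cauchy_ring p\<^esub> ?x"
  have t: "t = (\<lambda>n. of_int y * s n - of_int x)"
    unfolding t_def a_minus_def padic_Cauchy_ring_uminus[OF x] by (simp add: padic_Cauchy_ring_def)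
  have tC: "t \<in> padic_Cauchy p"
    unfolding t_def using assms x y by (simp add: carr[symmetric])
  have "padic_class t = (padic_of_rat p (of_int y) \<otimes>\<^bsub>padic_field p\<^esub> padic_class s)
      \<ominus>\<^bsub>padic_field p\<^esub> padic_of_rat p (of_int x)"
    unfolding t_def padic_of_rat_def a_minus_def using assms x y by (simp add: carr[symmetric])
  hence "padic_linear_form p (padic_class s) x y = padic_norm p (padic_class t)"
    by (simp add: padic_linear_form_def)
  thus ?thesis using padic_norm_class[OF tC] by (simp add: t)
qed

section \<open>Linear forms\<close>

lemma padic_linear_form_nonneg:
  assumes "s \<in> padic_Cauchy p"
  shows "padic_linear_form p (padic_class s) x y \<ge> 0"
  using LIMSEQ_le_const[OF padic_linear_form_tendsto[OF assms]] padic_abs_nonneg by blast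

lemma padic_linear_form_scale:
  assumes "s \<in> padic_Cauchy p"
  shows "padic_linear_form p (padic_class s) (t * x) (t * y)
           = padic_abs p (of_int t) * padic_linear_form p (padic_class s) x y"
proof (rule LIMSEQ_unique[OF padic_linear_form_tendsto[OF assms]])
  have "padic_abs p (of_int (t * y) * s n - of_int (t * x))
      = padic_abs p (of_int t) * padic_abs p (of_int y * s n - of_int x)" for n
    by (simp add: padic_abs_mult[symmetric] algebra_simps)
  thus "(\<lambda>n. padic_abs p (of_int (t * y) * s n - of_int (t * x)))
      \<longlonglongrightarrow> padic_abs p (of_int t) * padic_linear_form p (padic_class s) x y"
    by (simp only: tendsto_mult_left[OF padic_linear_form_tendsto[OF assms]])
qed

text \<open>Eliminating the p-adic number from two linear forms leaves the determinant of the two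
  integer pairs. The coefficients \<open>y\<close> and \<open>y'\<close> are integers, hence of
  absolute value at most 1, and the ultrametric inequality applies.\<close>

lemma padic_abs_det_le:
  assumes "s \<in> padic_Cauchy p"
  shows "padic_abs p (of_int (y * x' - x * y'))
           \<le> max (padic_linear_form p (padic_class s) x y) (padic_linear_form p (padic_class s) x' y')"
proof (rule LIMSEQ_le_const)
  show "(\<lambda>n. max (padic_abs p (of_int y * s n - of_int x)) (padic_abs p (of_int y' * s n - of_int x')))
      \<longlonglongrightarrow> max (padic_linear_form p (padic_class s) x y) (padic_linear_form p (padic_class s) x' y')"
    by (intro tendsto_max padic_linear_form_tendsto assms)
  show "\<exists>N. \<forall>n\<ge>N. padic_abs p (of_int (y * x' - x * y'))
      \<le> max (padic_abs p (of_int y * s n - of_int x)) (padic_abs p (of_int y' * s n - of_int x'))"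
  proof (intro exI[of _ 0] allI impI)
    fix n
    let ?u = "of_int y * s n - of_int x" and ?v = "of_int y' * s n - of_int x'"
    have "of_int (y * x' - x * y') = of_int y' * ?u - of_int y * ?v"
      by (simp add: algebra_simps)
    hence "padic_abs p (of_int (y * x' - x * y'))
        \<le> max (padic_abs p (of_int y' * ?u)) (padic_abs p (of_int y * ?v))"
      by (simp only: padic_abs_diff_le)
    also have "\<dots> \<le> max (1 * padic_abs p ?u) (1 * padic_abs p ?v)"
      unfolding padic_abs_mult
      by (intro max.mono mult_right_mono padic_abs_of_int_le_1 padic_abs_nonneg)
    finally show "padic_abs p (of_int (y * x' - x * y')) \<le> max (padic_abs p ?u) (padic_abs p ?v)"
      by simp
  qed
qed

lemma padic_linear_form_eq_0_iff:
  assumes "s \<in> padic_Cauchy p" "y \<noteq> 0"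
  shows "padic_linear_form p (padic_class s) x y = 0
           \<longleftrightarrow> padic_class s = padic_of_rat p (of_int x / of_int y)"
proof -
  have y: "padic_abs p (of_int y) > 0" using assms by (simp add: padic_abs_pos)
  have eq: "padic_abs p (of_int y * s n - of_int x)
      = padic_abs p (of_int y) * padic_abs p (s n - of_int x / of_int y)" for n
    using assms by (simp add: padic_abs_mult[symmetric] algebra_simps)
  have "padic_linear_form p (padic_class s) x y = 0
      \<longleftrightarrow> (\<lambda>n. padic_abs p (of_int y * s n - of_int x)) \<longlonglongrightarrow> 0"
    using padic_linear_form_tendsto[OF assms(1), of y x] by (auto intro: LIMSEQ_unique)
  also have "\<dots> \<longleftrightarrow> (\<lambda>n. padic_abs p (s n - of_int x / of_int y)) \<longlonglongrightarrow> 0"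
    unfolding eq using y tendsto_mult_left_iff[of "padic_abs p (of_int y)" _ 0] by simp
  also have "\<dots> \<longleftrightarrow> padic_class s = padic_of_rat p (of_int x / of_int y)"
    unfolding padic_of_rat_def by (simp add: padic_class_eq_iff assms padic_Cauchy_const)
  finally show ?thesis .
qed

text \<open>Irrationality in the form in which it is used and verified: no linear form with
  \<open>y\<close> nonzero vanishes.\<close>

lemma padic_irrationals_iff:
  "\<xi> \<in> padic_irrationals p \<longleftrightarrow> (\<exists>s \<in> padic_Cauchy p. \<xi> = padic_class s \<and>
     (\<forall>x y. y \<noteq> 0 \<longrightarrow> padic_linear_form p \<xi> x y > 0))"
proof
  assume "\<xi> \<in> padic_irrationals p"
  then obtain s where "s \<in> padic_Cauchy p" "\<xi> = padic_class s" "\<xi> \<notin> range (padic_of_rat p)"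
    unfolding padic_irrationals_def carrier_padic_field by blast
  thus "\<exists>s \<in> padic_Cauchy p. \<xi> = padic_class s \<and> (\<forall>x y. y \<noteq> 0 \<longrightarrow> padic_linear_form p \<xi> x y > 0)"
    using padic_linear_form_nonneg padic_linear_form_eq_0_iff
    by (metis less_eq_real_def rangeI)
next
  assume "\<exists>s \<in> padic_Cauchy p. \<xi> = padic_class s \<and> (\<forall>x y. y \<noteq> 0 \<longrightarrow> padic_linear_form p \<xi> x y > 0)"
  then obtain s where s: "s \<in> padic_Cauchy p" "\<xi> = padic_class s"
      "\<And>x y. y \<noteq> 0 \<Longrightarrow> padic_linear_form p \<xi> x y > 0" by blast
  have "\<xi> \<noteq> padic_of_rat p q" for q
  proof -
    obtain a b where "quotient_of q = (a, b)" by force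
    hence "b > 0" "q = of_int a / of_int b"
      using quotient_of_denom_pos quotient_of_div by blast+
    thus ?thesis using s(3)[of b a] padic_linear_form_eq_0_iff[OF s(1), of b a] s(2) by auto
  qed
  thus "\<xi> \<in> padic_irrationals p"
    using s unfolding padic_irrationals_def carrier_padic_field by blast
qed

text \<open>A rational of absolute value at most 1 has a denominator prime to \<open>p\<close>,
  which can be inverted modulo \<open>p ^ m\<close>.\<close>

lemma padic_integer_approx:
  assumes "padic_abs p r \<le> 1"
  shows "\<exists>x. 0 < x \<and> x \<le> int p ^ m \<and> padic_abs p (r - of_int x) \<le> 1 / real p ^ m"
proof -
  obtain a b where ab: "quotient_of r = (a, b)" by force
  have b: "b > 0" and r: "r = of_int a / of_int b" and cop: "coprime a b"
    using quotient_of_denom_pos[OF ab] quotient_of_div[OF ab] quotient_of_coprime[OF ab] by auto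
  have pb: "\<not> int p dvd b"
  proof
    assume pb: "int p dvd b"
    hence "\<not> int p dvd a"
      using cop prime_int_p by (meson not_coprimeI not_prime_unit)
    hence "padic_abs p (of_int a) = 1" by (rule padic_abs_of_int_eq_1)
    moreover have "of_int a = r * of_int b" using r b by simp
    ultimately have 1: "1 = padic_abs p r * padic_abs p (of_int b)" by (simp add: padic_abs_mult)
    have "padic_abs p (of_int b) \<le> 1 / real p ^ 1"
      using pb by (intro padic_abs_of_int_le_power) simp
    also have "\<dots> < 1" using p_gt_1 by simp
    finally have "padic_abs p (of_int b) < 1" .
    moreover have "padic_abs p r * padic_abs p (of_int b) \<le> 1 * padic_abs p (of_int b)"
      using assms padic_abs_nonneg by (intro mult_right_mono)
    ultimately show False using 1 by simp
  qed
  hence "coprime b (int p ^ m)"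
    using prime_imp_coprime[OF prime_int_p pb] by (simp add: coprime_commute)
  then obtain c where c: "[b * c = 1] (mod int p ^ m)"
    using cong_solve_coprime_int by blast
  \<comment> \<open>The shift by 1 selects the residue between 1 and \<open>p ^ m\<close>, because
    approximating pairs must have nonzero entries.\<close>
  define x where "x = 1 + (a * c - 1) mod int p ^ m"
  have pm: "int p ^ m > 0" using prime_gt_0_nat[OF prime_p] by simp
  have "[x = a * c] (mod int p ^ m)"
    unfolding x_def cong_def by (simp add: mod_simps)
  hence "[b * x = a * (b * c)] (mod int p ^ m)"
    using cong_scalar_left[of x "a * c" _ b] by (simp add: ac_simps)
  also have "[a * (b * c) = a * 1] (mod int p ^ m)" by (rule cong_scalar_left[OF c])
  finally have "int p ^ m dvd a - b * x"
    using cong_sym cong_iff_dvd_diff by fastforce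
  hence le: "padic_abs p (of_int (a - b * x)) \<le> 1 / real p ^ m" by (rule padic_abs_of_int_le_power)
  have "padic_abs p (of_int (a - b * x)) = padic_abs p (of_int b) * padic_abs p (r - of_int x)"
    using b by (simp add: padic_abs_mult[symmetric] r algebra_simps)
  also have "\<dots> = padic_abs p (r - of_int x)" by (simp add: padic_abs_of_int_eq_1[OF pb])
  finally have "padic_abs p (r - of_int x) \<le> 1 / real p ^ m" using le by simp
  moreover have "0 < x" "x \<le> int p ^ m"
    using pos_mod_sign[OF pm, of "a * c - 1"] pos_mod_bound[OF pm, of "a * c - 1"] by (auto simp: x_def)
  ultimately show ?thesis by blast
qed

text \<open>A fixed power \<open>p ^ k\<close> clears the denominator of the p-adic number. The same
  \<open>k\<close> serves every precision \<open>m\<close>, so the second coordinate stays constant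
  while the linear form tends to 0.\<close>

lemma padic_linear_form_approx:
  assumes "s \<in> padic_Cauchy p"
  shows "\<exists>k. \<forall>m. \<exists>x. 0 < x \<and> x \<le> int p ^ m \<and>
           padic_linear_form p (padic_class s) x (int p ^ k) \<le> 1 / real p ^ m"
proof -
  obtain B where B: "B > 0" "\<And>n. padic_abs p (s n) \<le> B"
    using padic_Cauchy_bounded[OF assms] by blast
  obtain k where k: "B < real p ^ k" using real_arch_pow[OF p_gt_1] by blast
  show ?thesis
  proof (intro exI[of _ k] allI)
    fix m
    let ?y = "of_int (int p ^ k) :: rat"
    have "1 / real p ^ m > 0" using p_gt_1 by simp
    \<comment> \<open>The integer is chosen for the single term \<open>s n0\<close>; later terms
      differ from it by less than the allowed error, so the same integer works for them.\<close>
    from padic_CauchyD[OF assms this] obtain n0 where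
      n0: "\<And>n. n \<ge> n0 \<Longrightarrow> padic_abs p (s n - s n0) < 1 / real p ^ m" by blast
    have "padic_abs p (?y * s n0) = padic_abs p (s n0) / real p ^ k"
      unfolding padic_abs_mult padic_abs_p_power by simp
    also have "\<dots> \<le> 1" using k B(2)[of n0] p_gt_1 by (simp add: field_simps)
    finally obtain x where x: "0 < x" "x \<le> int p ^ m"
        "padic_abs p (?y * s n0 - of_int x) \<le> 1 / real p ^ m"
      using padic_integer_approx by blast
    have "padic_abs p (?y * s n - of_int x) \<le> 1 / real p ^ m" if "n \<ge> n0" for n
    proof -
      have "padic_abs p (?y * (s n - s n0)) \<le> 1 * padic_abs p (s n - s n0)"
        unfolding padic_abs_mult by (intro mult_right_mono padic_abs_of_int_le_1 padic_abs_nonneg)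
      hence "padic_abs p (?y * (s n - s n0)) \<le> 1 / real p ^ m" using n0[OF that] by simp
      hence "padic_abs p (?y * (s n - s n0) + (?y * s n0 - of_int x)) \<le> 1 / real p ^ m"
        using x(3) by (intro order.trans[OF padic_abs_add_le] max.boundedI)
      moreover have "?y * (s n - s n0) + (?y * s n0 - of_int x) = ?y * s n - of_int x"
        by (simp only: algebra_simps)
      ultimately show ?thesis by (simp only:)
    qed
    hence "padic_linear_form p (padic_class s) x (int p ^ k) \<le> 1 / real p ^ m"
      by (intro LIMSEQ_le_const2[OF padic_linear_form_tendsto[OF assms]]) blast
    thus "\<exists>x. 0 < x \<and> x \<le> int p ^ m \<and>
        padic_linear_form p (padic_class s) x (int p ^ k) \<le> 1 / real p ^ m"
      using x by blast
  qed
qed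

end

section \<open>Irrationality exponents\<close>

definition approximations :: "nat \<Rightarrow> (nat \<Rightarrow> rat) set \<Rightarrow> real \<Rightarrow> (int \<times> int) set" where
  "approximations p \<xi> m = {(x, y). x \<noteq> 0 \<and> y \<noteq> 0 \<and> 0 < padic_linear_form p \<xi> x y \<and>
     padic_linear_form p \<xi> x y \<le> of_int (max \<bar>x\<bar> \<bar>y\<bar>) powr (- m)}"

definition mult_approximations :: "nat \<Rightarrow> (nat \<Rightarrow> rat) set \<Rightarrow> real \<Rightarrow> (int \<times> int) set" where
  "mult_approximations p \<xi> m = {(x, y). x \<noteq> 0 \<and> y \<noteq> 0 \<and> 0 < padic_linear_form p \<xi> x y \<and>
     padic_linear_form p \<xi> x y \<le> sqrt (of_int \<bar>x * y\<bar>) powr (- m)}"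

lemma irrationality_exponent_eq:
  "irrationality_exponent p \<xi> = Sup (ereal ` {m. infinite (approximations p \<xi> m)})"
  by (simp add: irrationality_exponent_def approximations_def)

lemma mult_irrationality_exponent_eq:
  "mult_irrationality_exponent p \<xi> = Sup (ereal ` {m. infinite (mult_approximations p \<xi> m)})"
  by (simp add: mult_irrationality_exponent_def mult_approximations_def)

text \<open>On a nonempty finite set a positive function has a positive minimum. Infinitely many
  solutions are therefore obtained from solutions with arbitrarily small linear form, positivity
  being part of both solution sets.\<close>

lemma infinite_if_arbitrarily_small:
  fixes f :: "'a \<Rightarrow> real"
  assumes "\<And>z. z \<in> S \<Longrightarrow> f z > 0" "\<And>e. e > 0 \<Longrightarrow> \<exists>z\<in>S. f z < e"
  shows "infinite S"
proof
  assume fin: "finite S"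
  have "S \<noteq> {}" using assms(2)[of 1] by auto
  hence "Min (f ` S) > 0" using fin assms(1) by simp
  from assms(2)[OF this] show False using fin by (metis Min_le finite_imageI imageI leD)
qed

lemma infinite_approximationsI:
  assumes "\<And>e. e > 0 \<Longrightarrow> \<exists>(x, y) \<in> approximations p \<xi> m. padic_linear_form p \<xi> x y < e"
  shows "infinite (approximations p \<xi> m)"
  by (rule infinite_if_arbitrarily_small[where f = "\<lambda>(x, y). padic_linear_form p \<xi> x y"])
    (use assms in \<open>fastforce simp: approximations_def\<close>)+

lemma infinite_mult_approximationsI:
  assumes "\<And>e. e > 0 \<Longrightarrow> \<exists>(x, y) \<in> mult_approximations p \<xi> m. padic_linear_form p \<xi> x y < e"
  shows "infinite (mult_approximations p \<xi> m)"
  by (rule infinite_if_arbitrarily_small[where f = "\<lambda>(x, y). padic_linear_form p \<xi> x y"])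
    (use assms in \<open>fastforce simp: mult_approximations_def\<close>)+

text \<open>Nonzero integers have absolute value at least 1, so the product of two of them dominates
  each factor. These inequalities compare the two heights.\<close>

lemma sqrt_abs_mult_bounds:
  fixes x y :: int
  assumes "x \<noteq> 0" "y \<noteq> 0"
  shows "1 \<le> sqrt (of_int \<bar>x * y\<bar>)"
    and "sqrt (of_int \<bar>x * y\<bar>) \<le> of_int (max \<bar>x\<bar> \<bar>y\<bar>)"
    and "of_int (max \<bar>x\<bar> \<bar>y\<bar>) \<le> (sqrt (of_int \<bar>x * y\<bar>))\<^sup>2"
proof -
  have x: "1 \<le> \<bar>x\<bar>" and y: "1 \<le> \<bar>y\<bar>" using assms by auto
  have "1 * 1 \<le> \<bar>x\<bar> * \<bar>y\<bar>" using x y by (intro mult_mono) auto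
  hence "1 \<le> \<bar>x * y\<bar>" by (simp add: abs_mult)
  thus "1 \<le> sqrt (of_int \<bar>x * y\<bar>)" by (metis of_int_1_le_iff real_sqrt_ge_one)
  have "\<bar>x * y\<bar> \<le> (max \<bar>x\<bar> \<bar>y\<bar>)\<^sup>2"
    unfolding power2_eq_square abs_mult using x y by (intro mult_mono) auto
  hence "real_of_int \<bar>x * y\<bar> \<le> of_int ((max \<bar>x\<bar> \<bar>y\<bar>)\<^sup>2)" by (simp only: of_int_le_iff)
  thus "sqrt (of_int \<bar>x * y\<bar>) \<le> of_int (max \<bar>x\<bar> \<bar>y\<bar>)"
    using x by (intro real_le_lsqrt) auto
  have "\<bar>x\<bar> * 1 \<le> \<bar>x\<bar> * \<bar>y\<bar>" "1 * \<bar>y\<bar> \<le> \<bar>x\<bar> * \<bar>y\<bar>"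
    using x y by (intro mult_mono; simp)+
  hence "max \<bar>x\<bar> \<bar>y\<bar> \<le> \<bar>x * y\<bar>" by (simp add: abs_mult)
  hence "real_of_int (max \<bar>x\<bar> \<bar>y\<bar>) \<le> of_int \<bar>x * y\<bar>" by (simp only: of_int_le_iff)
  thus "of_int (max \<bar>x\<bar> \<bar>y\<bar>) \<le> (sqrt (of_int \<bar>x * y\<bar>))\<^sup>2" by simp
qed

lemma one_le_max_abs:
  fixes x y :: int
  assumes "x \<noteq> 0 \<or> y \<noteq> 0"
  shows "(1 :: real) \<le> of_int (max \<bar>x\<bar> \<bar>y\<bar>)"
proof -
  have "1 \<le> max \<bar>x\<bar> \<bar>y\<bar>" using assms by auto
  thus ?thesis by (metis of_int_1_le_iff)
qed

lemma finite_int_box: "finite {(x :: int, y :: int). of_int (max \<bar>x\<bar> \<bar>y\<bar>) \<le> (B :: real)}"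
proof (rule finite_subset)
  show "{(x :: int, y :: int). of_int (max \<bar>x\<bar> \<bar>y\<bar>) \<le> B} \<subseteq> {-\<lfloor>B\<rfloor>..\<lfloor>B\<rfloor>} \<times> {-\<lfloor>B\<rfloor>..\<lfloor>B\<rfloor>}"
    by (auto simp: le_floor_iff[symmetric] simp del: of_int_abs)
qed auto

text \<open>When \<open>m\<close> exceeds \<open>\<mu>\<close>, a lower bound of order
  \<open>\<mu>\<close> and an upper bound of order \<open>m\<close> are compatible only for bounded
  heights \<open>h\<close>.\<close>

lemma powr_bounded_of_le:
  fixes c h :: real
  assumes "c > 0" "h \<ge> 1" "\<mu> < m" "c * h powr (- \<mu>) \<le> h powr (- m)"
  shows "h \<le> (1 / c) powr (1 / (m - \<mu>))"
proof -
  have "c * h powr (- \<mu>) * h powr m \<le> h powr (- m) * h powr m"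
    using assms by (intro mult_right_mono) auto
  hence "c * h powr (m - \<mu>) \<le> 1"
    using assms by (simp add: powr_add[symmetric] mult.assoc)
  hence "h powr (m - \<mu>) \<le> 1 / c" using assms by (simp add: field_simps)
  hence "(h powr (m - \<mu>)) powr (1 / (m - \<mu>)) \<le> (1 / c) powr (1 / (m - \<mu>))"
    using assms by (intro powr_mono2) auto
  thus ?thesis using assms by (simp add: powr_powr)
qed

text \<open>Above \<open>\<mu>\<close> all solutions have bounded height, and only finitely many
  integer pairs do.\<close>

lemma irrationality_exponent_le:
  assumes "c > 0" "\<And>x y. x \<noteq> 0 \<Longrightarrow> y \<noteq> 0 \<Longrightarrow>
    c * of_int (max \<bar>x\<bar> \<bar>y\<bar>) powr (- \<mu>) \<le> padic_linear_form p \<xi> x y"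
  shows "irrationality_exponent p \<xi> \<le> ereal \<mu>"
  unfolding irrationality_exponent_eq
proof (rule Sup_least, safe)
  fix m assume inf: "infinite (approximations p \<xi> m)"
  show "ereal m \<le> ereal \<mu>"
  proof (rule ccontr)
    assume "\<not> ereal m \<le> ereal \<mu>"
    hence "\<mu> < m" by simp
    have "of_int (max \<bar>x\<bar> \<bar>y\<bar>) \<le> (1 / c) powr (1 / (m - \<mu>))"
      if "(x, y) \<in> approximations p \<xi> m" for x y
      using that assms one_le_max_abs[of x y] \<open>\<mu> < m\<close>
      by (intro powr_bounded_of_le) (fastforce simp: approximations_def)+
    hence "approximations p \<xi> m
        \<subseteq> {(x, y). of_int (max \<bar>x\<bar> \<bar>y\<bar>) \<le> (1 / c) powr (1 / (m - \<mu>))}" by blast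
    with inf finite_int_box show False using finite_subset by blast
  qed
qed

lemma mult_irrationality_exponent_le:
  assumes "c > 0" "\<And>x y. x \<noteq> 0 \<Longrightarrow> y \<noteq> 0 \<Longrightarrow>
    c * sqrt (of_int \<bar>x * y\<bar>) powr (- \<mu>) \<le> padic_linear_form p \<xi> x y"
  shows "mult_irrationality_exponent p \<xi> \<le> ereal \<mu>"
  unfolding mult_irrationality_exponent_eq
proof (rule Sup_least, safe)
  fix m assume inf: "infinite (mult_approximations p \<xi> m)"
  show "ereal m \<le> ereal \<mu>"
  proof (rule ccontr)
    assume "\<not> ereal m \<le> ereal \<mu>"
    hence "\<mu> < m" by simp
    define B where "B = (1 / c) powr (1 / (m - \<mu>))"
    \<comment> \<open>A bound on the product of two nonzero integers bounds each of them, which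
      reduces finiteness to the box lemma.\<close>
    have "of_int (max \<bar>x\<bar> \<bar>y\<bar>) \<le> B\<^sup>2" if "(x, y) \<in> mult_approximations p \<xi> m" for x y
    proof -
      have xy: "x \<noteq> 0" "y \<noteq> 0" and le: "padic_linear_form p \<xi> x y \<le> sqrt (of_int \<bar>x * y\<bar>) powr (- m)"
        using that by (auto simp: mult_approximations_def)
      have "sqrt (of_int \<bar>x * y\<bar>) \<le> B"
        unfolding B_def using assms(1) sqrt_abs_mult_bounds(1)[OF xy] \<open>\<mu> < m\<close>
        by (rule powr_bounded_of_le) (rule order.trans[OF assms(2)[OF xy] le])
      hence "(sqrt (of_int \<bar>x * y\<bar>))\<^sup>2 \<le> B\<^sup>2"
        using sqrt_abs_mult_bounds(1)[OF xy] by (intro power_mono) auto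
      thus ?thesis using sqrt_abs_mult_bounds(3)[OF xy] by linarith
    qed
    hence "mult_approximations p \<xi> m \<subseteq> {(x, y). of_int (max \<bar>x\<bar> \<bar>y\<bar>) \<le> B\<^sup>2}" by blast
    with inf finite_int_box show False using finite_subset by blast
  qed
qed

lemma le_Sup_erealI:
  assumes "\<And>m. 0 < m \<Longrightarrow> m < \<mu> \<Longrightarrow> m \<in> S" "0 < \<mu>"
  shows "ereal \<mu> \<le> Sup (ereal ` S)"
proof (rule ccontr)
  assume "\<not> ereal \<mu> \<le> Sup (ereal ` S)"
  then obtain m where m: "Sup (ereal ` S) < ereal m" "ereal m < ereal \<mu>"
    using ereal_dense2 by (metis not_le)
  \<comment> \<open>The separating \<open>m\<close> may be negative or zero; taking the maximum with
    \<open>\<mu> / 2\<close> moves it into the range that the hypothesis covers.\<close>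
  have "max m (\<mu> / 2) \<in> S" using m assms by (intro assms(1)) auto
  hence "ereal (max m (\<mu> / 2)) \<le> Sup (ereal ` S)" by (intro Sup_upper imageI)
  moreover have "ereal m \<le> ereal (max m (\<mu> / 2))" by simp
  ultimately show False using m by (meson leD order.trans)
qed

lemma irrationality_exponent_ge:
  assumes "0 < \<mu>" "\<And>m e. 0 < m \<Longrightarrow> m < \<mu> \<Longrightarrow> e > 0 \<Longrightarrow>
    \<exists>(x, y) \<in> approximations p \<xi> m. padic_linear_form p \<xi> x y < e"
  shows "ereal \<mu> \<le> irrationality_exponent p \<xi>"
  unfolding irrationality_exponent_eq
  using assms by (intro le_Sup_erealI) (simp_all add: infinite_approximationsI)

lemma mult_irrationality_exponent_ge:
  assumes "0 < \<mu>" "\<And>m e. 0 < m \<Longrightarrow> m < \<mu> \<Longrightarrow> e > 0 \<Longrightarrow>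
    \<exists>(x, y) \<in> mult_approximations p \<xi> m. padic_linear_form p \<xi> x y < e"
  shows "ereal \<mu> \<le> mult_irrationality_exponent p \<xi>"
  unfolding mult_irrationality_exponent_eq
  using assms by (intro le_Sup_erealI) (simp_all add: infinite_mult_approximationsI)

lemma approximations_subset_mult:
  assumes "m \<ge> 0"
  shows "approximations p \<xi> m \<subseteq> mult_approximations p \<xi> m"
proof safe
  fix x y assume A: "(x, y) \<in> approximations p \<xi> m"
  hence xy: "x \<noteq> 0" "y \<noteq> 0" by (auto simp: approximations_def)
  have "of_int (max \<bar>x\<bar> \<bar>y\<bar>) powr (- m) \<le> sqrt (of_int \<bar>x * y\<bar>) powr (- m)"
    using sqrt_abs_mult_bounds[OF xy] assms by (intro powr_mono2') auto
  thus "(x, y) \<in> mult_approximations p \<xi> m"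
    using A by (auto simp: approximations_def mult_approximations_def)
qed

text \<open>Here \<open>sqrt \<bar>x * y\<bar>\<close> to the power \<open>- m\<close> equals
  \<open>\<bar>x * y\<bar>\<close> to the power \<open>- m / 2\<close>, and the product dominates
  the maximum.\<close>

lemma mult_approximations_subset:
  assumes "m \<ge> 0"
  shows "mult_approximations p \<xi> m \<subseteq> approximations p \<xi> (m / 2)"
proof safe
  fix x y assume A: "(x, y) \<in> mult_approximations p \<xi> m"
  hence xy: "x \<noteq> 0" "y \<noteq> 0" by (auto simp: mult_approximations_def)
  let ?h = "sqrt (of_int \<bar>x * y\<bar>)"
  have h: "?h \<ge> 1" by (rule sqrt_abs_mult_bounds[OF xy])
  have "?h powr (- m) = (?h powr 2) powr (- (m / 2))" by (simp only: powr_powr) simp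
  also have "?h powr 2 = ?h\<^sup>2" using h by (intro powr_numeral) auto
  also have "(?h\<^sup>2) powr (- (m / 2)) \<le> of_int (max \<bar>x\<bar> \<bar>y\<bar>) powr (- (m / 2))"
    using sqrt_abs_mult_bounds(3)[OF xy] one_le_max_abs[of x y] xy assms
    by (intro powr_mono2') auto
  finally show "(x, y) \<in> approximations p \<xi> (m / 2)"
    using A by (auto simp: approximations_def mult_approximations_def)
qed

section \<open>Inequalities between the two exponents of an arbitrary irrational number\<close>

context padic_prime
begin

text \<open>The pairs \<open>(x, p ^ k)\<close> with \<open>k\<close> fixed already achieve exponent
  1. This makes the exponent positive, as division by it requires, and it settles negative
  \<open>m\<close> in the comparisons below.\<close>

lemma infinite_approximations_1:
  assumes "\<xi> \<in> padic_irrationals p"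
  shows "infinite (approximations p \<xi> 1)"
proof (rule infinite_approximationsI)
  fix e :: real assume "e > 0"
  obtain s where s: "s \<in> padic_Cauchy p" "\<xi> = padic_class s"
      "\<And>x y. y \<noteq> 0 \<Longrightarrow> padic_linear_form p \<xi> x y > 0"
    using assms unfolding padic_irrationals_iff by blast
  obtain k where k: "\<And>m. \<exists>x. 0 < x \<and> x \<le> int p ^ m \<and>
      padic_linear_form p \<xi> x (int p ^ k) \<le> 1 / real p ^ m"
    using padic_linear_form_approx[OF s(1)] s(2) by blast
  obtain j where j: "1 / e < real p ^ j" using real_arch_pow[OF p_gt_1] by blast
  \<comment> \<open>The index \<open>j\<close> makes the form smaller than \<open>e\<close>;
    \<open>k\<close> keeps the second coordinate below \<open>p ^ m\<close>, so that the height is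
    at most \<open>p ^ m\<close>.\<close>
  define m where "m = max j k"
  have "real p ^ j \<le> real p ^ m" using p_gt_1 by (intro power_increasing) (auto simp: m_def)
  hence "1 / e < real p ^ m" using j by linarith
  hence m: "1 / real p ^ m < e" using \<open>e > 0\<close> p_gt_1 by (simp add: field_simps)
  obtain x where x: "0 < x" "x \<le> int p ^ m" "padic_linear_form p \<xi> x (int p ^ k) \<le> 1 / real p ^ m"
    using k by blast
  have pk: "0 < int p ^ k" "int p ^ k \<le> int p ^ m"
    using prime_gt_0_nat[OF prime_p] by (auto intro!: power_increasing simp: m_def)
  have "max \<bar>x\<bar> \<bar>int p ^ k\<bar> \<le> int p ^ m" using x pk by simp
  hence "real_of_int (max \<bar>x\<bar> \<bar>int p ^ k\<bar>) \<le> of_int (int p ^ m)" by (simp only: of_int_le_iff)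
  hence le: "real_of_int (max \<bar>x\<bar> \<bar>int p ^ k\<bar>) \<le> real p ^ m" by simp
  have ge: "1 \<le> real_of_int (max \<bar>x\<bar> \<bar>int p ^ k\<bar>)" using x by (intro one_le_max_abs) auto
  have "1 / real p ^ m \<le> 1 / real_of_int (max \<bar>x\<bar> \<bar>int p ^ k\<bar>)"
    by (rule divide_left_mono[OF le]) (use ge p_gt_1 in \<open>auto intro!: mult_pos_pos\<close>)
  also have "\<dots> = real_of_int (max \<bar>x\<bar> \<bar>int p ^ k\<bar>) powr (- 1)"
    using powr_minus_divide[of "real_of_int (max \<bar>x\<bar> \<bar>int p ^ k\<bar>)" 1] ge
    by (simp only: powr_one)
  finally have "1 / real p ^ m \<le> real_of_int (max \<bar>x\<bar> \<bar>int p ^ k\<bar>) powr (- 1)" .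
  hence "(x, int p ^ k) \<in> approximations p \<xi> 1"
    using x pk s(3)[of "int p ^ k" x] by (auto simp: approximations_def simp del: of_int_abs)
  thus "\<exists>(x, y) \<in> approximations p \<xi> 1. padic_linear_form p \<xi> x y < e"
    using x(3) m by (intro bexI[of _ "(x, int p ^ k)"]) auto
qed

lemma irrationality_exponent_ge_1:
  assumes "\<xi> \<in> padic_irrationals p"
  shows "1 \<le> irrationality_exponent p \<xi>"
  unfolding irrationality_exponent_eq one_ereal_def
  using infinite_approximations_1[OF assms] by (intro Sup_upper) auto

lemma irrationality_exponent_le_mult:
  assumes "\<xi> \<in> padic_irrationals p"
  shows "irrationality_exponent p \<xi> \<le> mult_irrationality_exponent p \<xi>"
  unfolding irrationality_exponent_eq[of p \<xi>]
proof (rule Sup_least, safe)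
  have up: "ereal m \<le> mult_irrationality_exponent p \<xi>"
    if "infinite (approximations p \<xi> m)" "m \<ge> 0" for m
    unfolding mult_irrationality_exponent_eq
    using that infinite_super[OF approximations_subset_mult] by (intro Sup_upper) auto
  fix m assume inf: "infinite (approximations p \<xi> m)"
  show "ereal m \<le> mult_irrationality_exponent p \<xi>"
  proof (cases "m \<ge> 0")
    \<comment> \<open>For negative \<open>m\<close> the comparison of powers reverses, so the bound
      goes through exponent 1 instead.\<close>
    case False
    hence "ereal m \<le> ereal 1" by simp
    also have "ereal 1 \<le> mult_irrationality_exponent p \<xi>"
      by (rule up[OF infinite_approximations_1[OF assms]]) simp
    finally show ?thesis .
  qed (use up inf in blast)
qed

lemma mult_irrationality_exponent_le_twice:
  assumes "\<xi> \<in> padic_irrationals p" "irrationality_exponent p \<xi> = ereal \<mu>"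
  shows "mult_irrationality_exponent p \<xi> \<le> ereal (2 * \<mu>)"
  unfolding mult_irrationality_exponent_eq
proof (rule Sup_least, safe)
  fix m assume inf: "infinite (mult_approximations p \<xi> m)"
  show "ereal m \<le> ereal (2 * \<mu>)"
  proof (cases "m \<ge> 0")
    case True
    hence "infinite (approximations p \<xi> (m / 2))"
      using inf infinite_super[OF mult_approximations_subset] by blast
    hence "ereal (m / 2) \<le> irrationality_exponent p \<xi>"
      unfolding irrationality_exponent_eq by (intro Sup_upper) auto
    thus ?thesis using assms by simp
  next
    case False
    thus ?thesis using irrationality_exponent_ge_1[OF assms(1)] assms(2) by simp
  qed
qed

text \<open>Since \<open>\<mu>\<close> is finite and at least 1, both exponents are real and the
  extended quotient is an ordinary one.\<close>

lemma exponent_ratio_range: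
  assumes "\<xi> \<in> padic_irrationals p" "irrationality_exponent p \<xi> < \<infinity>"
  shows "mult_irrationality_exponent p \<xi> / irrationality_exponent p \<xi> \<in> ereal ` {1..2}"
proof -
  obtain \<mu> where \<mu>: "irrationality_exponent p \<xi> = ereal \<mu>" "\<mu> \<ge> 1"
    using assms irrationality_exponent_ge_1[OF assms(1)]
    by (cases "irrationality_exponent p \<xi>") auto
  have "ereal \<mu> \<le> mult_irrationality_exponent p \<xi>" "mult_irrationality_exponent p \<xi> \<le> ereal (2 * \<mu>)"
    using irrationality_exponent_le_mult mult_irrationality_exponent_le_twice assms(1) \<mu>(1)
    by metis+
  then obtain \<nu> where "mult_irrationality_exponent p \<xi> = ereal \<nu>" "\<mu> \<le> \<nu>" "\<nu> \<le> 2 * \<mu>"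
    by (cases "mult_irrationality_exponent p \<xi>") auto
  thus ?thesis using \<mu> by (auto intro!: image_eqI[of _ _ "\<nu> / \<mu>"] simp: field_simps)
qed

end

section \<open>A number with prescribed best approximations\<close>

text \<open>The data of the construction. The height of \<open>(x k, y k)\<close> is about
  \<open>p ^ N k\<close>, the product of its entries about \<open>p\<close> to the power
  \<open>(1 + a) * N k\<close>, and the linear form about \<open>p\<close> to the power
  \<open>- \<mu> * N k\<close>. Comparing these gives \<open>\<mu> = (1 + a) * \<mu>x / 2\<close>.
  The constants \<open>C\<close> and \<open>D\<close> absorb bounded factors.\<close>

locale prescribed_approximations = padic_prime +
  fixes N :: "nat \<Rightarrow> nat" and x y :: "nat \<Rightarrow> int" and a C D \<mu> \<mu>x :: real
  assumes N0: "N 0 \<ge> 1"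
    and N_double: "2 * N k \<le> N (Suc k)"
    and N_lower: "\<mu> * real (N k) \<le> real (N (Suc k))"
    and N_upper: "real (N (Suc k)) \<le> \<mu> * real (N k) + 1"
    and x_lower: "real p ^ N k \<le> of_int (x k)"
    and x_upper: "of_int (x k) \<le> C * real p ^ N k"
    and y_pos: "y k > 0"
    and y_lower: "real p powr (a * real (N k)) \<le> D * of_int (y k)"
    and y_upper: "of_int (y k) \<le> real p powr (a * real (N k))"
    and coprime_xy: "coprime (x k) (y k)"
    and p_not_dvd_y: "\<not> int p dvd y k"
    and det: "\<exists>w. x (Suc k) * y k - x k * y (Suc k) = int p ^ N (Suc k) * w \<and> \<not> int p dvd w"
    and a_range: "0 \<le> a" "a \<le> 1"
    and exponents: "\<mu> = (1 + a) * \<mu>x / 2" "\<mu>x \<ge> 6"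
begin

lemma \<mu>_ge_3: "\<mu> \<ge> 3"
proof -
  have "(1 + a) * \<mu>x \<ge> 1 * 6" using a_range exponents(2) by (intro mult_mono) auto
  thus ?thesis using exponents(1) by simp
qed

lemma N_pos: "N k \<ge> 1"
proof (induction k)
  case (Suc k)
  thus ?case using N_double[of k] by linarith
qed (rule N0)

lemma N_less_Suc: "N k < N (Suc k)"
  using N_double[of k] N_pos[of k] by linarith

lemma N_strict_mono: "strict_mono N"
  using N_less_Suc by (simp add: strict_mono_Suc_iff)

lemma N_ge: "k \<le> N k"
  using N_strict_mono by (rule strict_mono_imp_increasing)

lemma C_ge_1: "C \<ge> 1"
proof -
  have "1 * real p ^ N 0 \<le> C * real p ^ N 0" using order.trans[OF x_lower x_upper] by simp
  thus ?thesis using p_gt_1 by (simp only: mult_le_cancel_right) (auto simp: not_less)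
qed

lemma x_pos: "x k > 0"
proof -
  have "0 < real p ^ N k" using p_gt_1 by simp
  hence "0 < real_of_int (x k)" using x_lower[of k] by linarith
  thus ?thesis by simp
qed

lemma D_pos: "D > 0"
proof (rule ccontr)
  assume "\<not> D > 0"
  hence "D * of_int (y 0) \<le> 0" using y_pos[of 0] by (simp add: mult_nonpos_nonneg)
  moreover have "real p powr (a * real (N 0)) > 0" using p_gt_1 by simp
  ultimately show False using y_lower[of 0] by linarith
qed

lemma y_upper': "of_int (y k) \<le> real p ^ N k"
proof -
  have "real p powr (a * real (N k)) \<le> real p powr (1 * real (N k))"
    using p_gt_1 a_range by (intro powr_mono mult_right_mono) auto
  thus ?thesis using y_upper[of k] p_gt_1 by (simp add: powr_realpow)
qed

definition convergent_seq :: "nat \<Rightarrow> rat" where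
  "convergent_seq k = of_int (x k) / of_int (y k)"

abbreviation target :: "(nat \<Rightarrow> rat) set" where "target \<equiv> padic_class convergent_seq"

lemma padic_abs_y: "padic_abs p (of_int (y k)) = 1"
  by (rule padic_abs_of_int_eq_1[OF p_not_dvd_y])

text \<open>The denominators are p-adic units, so the distance of consecutive fractions is the
  absolute value of their determinant, known exactly from \<open>det\<close>.\<close>

lemma convergent_seq_step:
  "padic_abs p (convergent_seq (Suc k) - convergent_seq k) = 1 / real p ^ N (Suc k)"
proof -
  obtain w where w: "x (Suc k) * y k - x k * y (Suc k) = int p ^ N (Suc k) * w" "\<not> int p dvd w"
    using det by blast
  have "of_int (y k) * (of_int (y (Suc k)) * (convergent_seq (Suc k) - convergent_seq k))
      = of_int (x (Suc k) * y k - x k * y (Suc k))"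
    using y_pos[of k] y_pos[of "Suc k"] by (simp add: convergent_seq_def field_simps)
  hence "padic_abs p (of_int (y k) * (of_int (y (Suc k)) * (convergent_seq (Suc k) - convergent_seq k)))
      = padic_abs p (of_int (int p ^ N (Suc k)) * of_int w)"
    unfolding w(1) by (simp only: of_int_mult)
  thus ?thesis
    unfolding padic_abs_mult padic_abs_y padic_abs_p_power padic_abs_of_int_eq_1[OF w(2)] by simp
qed

lemma inverse_power_N_less: "j < k \<Longrightarrow> 1 / real p ^ N k < 1 / real p ^ N j"
  using p_gt_1 N_strict_mono by (simp add: field_simps strict_mono_less)

text \<open>Each increment is strictly smaller than all earlier ones because \<open>N\<close>
  increases, so the first increment after index \<open>k\<close> determines the distance.\<close>

lemma convergent_seq_dist:
  assumes "k < n"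
  shows "padic_abs p (convergent_seq n - convergent_seq k) = 1 / real p ^ N (Suc k)"
  using Suc_leI[OF assms]
proof (induction n rule: dec_induct)
  case base
  show ?case by (rule convergent_seq_step)
next
  case (step n)
  have "padic_abs p (convergent_seq (Suc n) - convergent_seq k - (convergent_seq n - convergent_seq k))
      = 1 / real p ^ N (Suc n)"
    by (simp add: convergent_seq_step)
  also have "\<dots> < padic_abs p (convergent_seq n - convergent_seq k)"
    unfolding step.IH using step by (intro inverse_power_N_less) simp
  finally show ?case using padic_abs_eq_of_dist_less step.IH by metis
qed

lemma inverse_power_N_small:
  assumes "e > 0"
  shows "\<exists>K. \<forall>k\<ge>K. 1 / real p ^ N k < e"
proof -
  obtain K where K: "1 / e < real p ^ K" using real_arch_pow[OF p_gt_1] by blast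
  have "1 / real p ^ N k < e" if "k \<ge> K" for k
  proof -
    have "real p ^ K \<le> real p ^ N k"
      using p_gt_1 that N_ge[of k] by (intro power_increasing) auto
    hence "1 / e < real p ^ N k" using K by linarith
    thus ?thesis using assms p_gt_1 by (simp add: field_simps)
  qed
  thus ?thesis by blast
qed

lemma convergent_seq_Cauchy: "convergent_seq \<in> padic_Cauchy p"
proof (rule padic_CauchyI)
  fix e :: real assume "e > 0"
  then obtain K where K: "\<And>k. k \<ge> K \<Longrightarrow> 1 / real p ^ N k < e" using inverse_power_N_small by blast
  have le: "padic_abs p (convergent_seq n - convergent_seq K) < e" if "n \<ge> K" for n
    using that K[of "Suc K"] \<open>e > 0\<close> convergent_seq_dist[of K n] by (cases "n = K") auto
  show "\<exists>N. \<forall>m\<ge>N. \<forall>n\<ge>N. padic_abs p (convergent_seq m - convergent_seq n) < e"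
  proof (intro exI[of _ K] allI impI)
    fix m n assume "m \<ge> K" "n \<ge> K"
    thus "padic_abs p (convergent_seq m - convergent_seq n) < e"
      using le[of m] le[of n]
        padic_abs_diff_le[of "convergent_seq m - convergent_seq K" "convergent_seq n - convergent_seq K"]
      by simp
  qed
qed

text \<open>The absolute values along the sequence are constant from index \<open>Suc k\<close> on,
  which gives the limit exactly.\<close>

lemma linear_form_approximant: "padic_linear_form p target (x k) (y k) = 1 / real p ^ N (Suc k)"
proof (rule LIMSEQ_unique[OF padic_linear_form_tendsto[OF convergent_seq_Cauchy]])
  have "padic_abs p (of_int (y k) * convergent_seq n - of_int (x k)) = 1 / real p ^ N (Suc k)"
    if "n \<ge> Suc k" for n
  proof -
    have "of_int (y k) * convergent_seq n - of_int (x k)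
        = of_int (y k) * (convergent_seq n - convergent_seq k)"
      using y_pos[of k] by (simp add: convergent_seq_def field_simps)
    thus ?thesis using that by (simp only: padic_abs_mult padic_abs_y) (simp add: convergent_seq_dist)
  qed
  thus "(\<lambda>n. padic_abs p (of_int (y k) * convergent_seq n - of_int (x k)))
      \<longlonglongrightarrow> 1 / real p ^ N (Suc k)"
    by (intro tendsto_eventually eventually_sequentiallyI[of "Suc k"])
qed

section \<open>Lower bounds for linear forms at the constructed number\<close>

text \<open>The determinant with the \<open>k\<close>-th approximant is a nonzero integer of size at
  most \<open>2 * C * H * p ^ N k\<close>. If that is less than \<open>p ^ N (Suc k)\<close>, its
  absolute value exceeds the form of the approximant, so the bound from
  \<open>padic_abs_det_le\<close> must come from the form at \<open>(u, v)\<close>.\<close>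

lemma linear_form_not_proportional:
  assumes "u \<noteq> 0 \<or> v \<noteq> 0" and "\<And>k. u * y k \<noteq> v * x k"
  defines "H \<equiv> real_of_int (max \<bar>u\<bar> \<bar>v\<bar>)"
  shows "1 / ((2 * C) ^ 3 * real p ^ N 0) / H ^ 3 \<le> padic_linear_form p target u v"
proof -
  let ?P = "\<lambda>k. 2 * C * H * real p ^ N k < real p ^ N (Suc k)"
  have H: "H \<ge> 1" unfolding H_def by (rule one_le_max_abs[OF assms(1)])
  have "2 * C * H \<ge> 1 * 1" using H C_ge_1 by (intro mult_mono) auto
  hence CH: "2 * C * H \<ge> 1" by simp
  have double: "real p ^ N k * real p ^ N k \<le> real p ^ N (Suc k)" for k
    using p_gt_1 N_double[of k] by (simp add: power_add[symmetric] mult_2[symmetric])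
  have p_pow: "real p ^ n > 0" for n using p_gt_1 by simp
  have "\<exists>k. ?P k"
  proof -
    obtain k where k: "2 * C * H < real p ^ k" using real_arch_pow[OF p_gt_1] by blast
    have "real p ^ k \<le> real p ^ N k" using p_gt_1 N_ge by (intro power_increasing) auto
    hence "2 * C * H < real p ^ N k" using k by linarith
    hence "2 * C * H * real p ^ N k < real p ^ N k * real p ^ N k"
      using p_pow by (intro mult_strict_right_mono)
    thus ?thesis using double[of k] by (intro exI[of _ k]) linarith
  qed
  \<comment> \<open>The least such \<open>k\<close> is taken so that failure at the preceding index
    bounds \<open>p ^ N k\<close> in terms of \<open>H\<close>.\<close>
  then obtain k where k: "?P k" and least: "\<And>j. j < k \<Longrightarrow> \<not> ?P j"
    using exists_least_iff[of ?P] by blast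
  define d where "d = v * x k - u * y k"
  have d0: "d \<noteq> 0" using assms(2)[of k] by (simp add: d_def)
  have "real_of_int \<bar>d\<bar> \<le> real_of_int \<bar>v\<bar> * of_int (x k) + real_of_int \<bar>u\<bar> * of_int (y k)"
    unfolding d_def using abs_triangle_ineq4[of "real_of_int (v * x k)" "real_of_int (u * y k)"]
      x_pos[of k] y_pos[of k] by (simp add: abs_mult)
  also have "\<dots> \<le> H * (C * real p ^ N k) + H * (C * real p ^ N k)"
  proof (intro add_mono mult_mono x_upper)
    show "real_of_int (y k) \<le> C * real p ^ N k"
      using y_upper'[of k] mult_right_mono[OF C_ge_1, of "real p ^ N k"] p_pow[of "N k"] by linarith
  qed (use H x_pos[of k] y_pos[of k] in \<open>auto simp: H_def\<close>)
  finally have d_le: "real_of_int \<bar>d\<bar> \<le> 2 * C * H * real p ^ N k" by simp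
  have "1 / (2 * C * H * real p ^ N k) \<le> 1 / real_of_int \<bar>d\<bar>"
    using d_le d0 CH p_pow[of "N k"] by (intro divide_left_mono) (auto intro!: mult_pos_pos)
  also have "\<dots> \<le> padic_abs p (of_int d)" by (rule padic_abs_of_int_ge[OF d0])
  also have "\<dots> \<le> max (padic_linear_form p target u v) (1 / real p ^ N (Suc k))"
    using padic_abs_det_le[OF convergent_seq_Cauchy, of v "x k" u "y k"]
    unfolding d_def linear_form_approximant .
  finally have "1 / (2 * C * H * real p ^ N k)
      \<le> max (padic_linear_form p target u v) (1 / real p ^ N (Suc k))" .
  moreover have "1 / real p ^ N (Suc k) < 1 / (2 * C * H * real p ^ N k)"
    using k C_ge_1 H p_pow by (intro divide_strict_left_mono mult_pos_pos) auto
  ultimately have L: "1 / (2 * C * H * real p ^ N k) \<le> padic_linear_form p target u v" by simp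
  \<comment> \<open>Origin of the exponent 3: for \<open>k = Suc j\<close>, failure at
    \<open>j\<close> together with \<open>2 * N j \<le> N k\<close> gives first
    \<open>p ^ N j \<le> 2 * C * H\<close> and then \<open>p ^ N k \<le> (2 * C * H)^2\<close>. The
    factor \<open>p ^ N 0\<close> takes care of \<open>k = 0\<close>.\<close>
  have "2 * C * H * real p ^ N k \<le> (2 * C * H) ^ 3 * real p ^ N 0"
  proof (cases k)
    case 0
    have "(2 * C * H) ^ 1 \<le> (2 * C * H) ^ 3" using CH by (intro power_increasing) auto
    thus ?thesis using 0 p_pow by (simp add: mult_right_mono)
  next
    case (Suc j)
    have 1: "real p ^ N k \<le> 2 * C * H * real p ^ N j" using least[of j] Suc by simp
    hence "real p ^ N j * real p ^ N j \<le> 2 * C * H * real p ^ N j"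
      using double[of j] Suc by simp
    hence "real p ^ N j \<le> 2 * C * H" using p_pow[of "N j"] by (simp only: mult_le_cancel_right)
    hence "2 * C * H * real p ^ N j \<le> 2 * C * H * (2 * C * H)"
      using CH by (intro mult_left_mono) auto
    hence "real p ^ N k \<le> 2 * C * H * (2 * C * H)" using 1 by linarith
    hence "2 * C * H * real p ^ N k \<le> 2 * C * H * (2 * C * H * (2 * C * H))"
      using CH by (intro mult_left_mono) auto
    hence "2 * C * H * real p ^ N k \<le> (2 * C * H) ^ 3 * 1" by (simp add: power3_eq_cube)
    also have "\<dots> \<le> (2 * C * H) ^ 3 * real p ^ N 0"
      using CH p_gt_1 by (intro mult_left_mono) auto
    finally show ?thesis .
  qed
  hence "1 / ((2 * C * H) ^ 3 * real p ^ N 0) \<le> 1 / (2 * C * H * real p ^ N k)"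
    using C_ge_1 H p_gt_1
    by (intro divide_left_mono mult_pos_pos zero_less_power) auto
  also have "\<dots> \<le> padic_linear_form p target u v" by (rule L)
  finally show ?thesis by (simp add: power_mult_distrib ac_simps)
qed

text \<open>Since the approximants are in lowest terms, a proportional pair is an integer multiple
  of one. The multiplier \<open>t\<close> may contain powers of \<open>p\<close>, but it shrinks the
  form by at most the factor \<open>1 / \<bar>t\<bar>\<close>.\<close>

lemma linear_form_proportional:
  assumes "u \<noteq> 0 \<or> v \<noteq> 0" and "u * y k = v * x k"
  obtains t where "t \<noteq> 0" "u = t * x k" "v = t * y k"
    "1 / (real p * of_int \<bar>t\<bar>) * (real p ^ N k) powr (- \<mu>) \<le> padic_linear_form p target u v"
proof -
  have "y k dvd v * x k" unfolding assms(2)[symmetric] by simp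
  hence "y k dvd v" using coprime_xy[of k] by (simp add: coprime_commute coprime_dvd_mult_left_iff)
  then obtain t where v: "v = t * y k" by (metis dvd_def mult.commute)
  have "u * y k = (t * x k) * y k" using assms(2) v by simp
  hence u: "u = t * x k" using y_pos[of k] by simp
  have t: "t \<noteq> 0" using assms(1) u v by auto
  \<comment> \<open>The rounding allowed in \<open>N_upper\<close> costs one factor
    \<open>p\<close>, visible in the constant of the bound.\<close>
  have "real p ^ N (Suc k) = real p powr real (N (Suc k))" using p_gt_1 by (simp add: powr_realpow)
  also have "\<dots> \<le> real p powr (real (N k) * \<mu> + 1)"
    using N_upper[of k] p_gt_1 by (intro powr_mono) (auto simp: mult.commute)
  also have "\<dots> = real p * (real p ^ N k) powr \<mu>"
    using p_gt_1 by (simp add: powr_add powr_powr[symmetric] powr_realpow)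
  finally have le: "real p ^ N (Suc k) \<le> real p * (real p ^ N k) powr \<mu>" .
  have "1 / (real p * of_int \<bar>t\<bar>) * (real p ^ N k) powr (- \<mu>)
      = 1 / of_int \<bar>t\<bar> * (1 / (real p * (real p ^ N k) powr \<mu>))"
    by (simp add: powr_minus_divide)
  also have "\<dots> \<le> padic_abs p (of_int t) * (1 / real p ^ N (Suc k))"
    using padic_abs_of_int_ge[OF t] le p_gt_1 padic_abs_nonneg
    by (intro mult_mono divide_left_mono mult_pos_pos) auto
  also have "\<dots> = padic_linear_form p target u v"
    unfolding u v padic_linear_form_scale[OF convergent_seq_Cauchy] linear_form_approximant ..
  finally show ?thesis using that t u v by blast
qed

lemma linear_form_pos:
  assumes "u \<noteq> 0 \<or> v \<noteq> 0"
  shows "padic_linear_form p target u v > 0"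
proof (cases "\<exists>k. u * y k = v * x k")
  case True
  then obtain k where "u * y k = v * x k" by blast
  from linear_form_proportional[OF assms this] obtain t where
    "t \<noteq> 0" "1 / (real p * of_int \<bar>t\<bar>) * (real p ^ N k) powr (- \<mu>) \<le> padic_linear_form p target u v"
    by blast
  moreover have "1 / (real p * of_int \<bar>t\<bar>) * (real p ^ N k) powr (- \<mu>) > 0"
    using p_gt_1 \<open>t \<noteq> 0\<close> by (intro mult_pos_pos divide_pos_pos) auto
  ultimately show ?thesis by linarith
next
  case False
  hence "1 / ((2 * C) ^ 3 * real p ^ N 0) / real_of_int (max \<bar>u\<bar> \<bar>v\<bar>) ^ 3
      \<le> padic_linear_form p target u v"
    using linear_form_not_proportional[OF assms] by blast
  moreover have "1 / ((2 * C) ^ 3 * real p ^ N 0) / real_of_int (max \<bar>u\<bar> \<bar>v\<bar>) ^ 3 > 0"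
    using C_ge_1 p_gt_1 one_le_max_abs[OF assms] by (intro divide_pos_pos mult_pos_pos zero_less_power) auto
  ultimately show ?thesis by linarith
qed

lemma target_irrational: "target \<in> padic_irrationals p"
  unfolding padic_irrationals_iff using convergent_seq_Cauchy linear_form_pos by blast

section \<open>Upper bounds for the two exponents\<close>

lemma irrationality_exponent_target_le: "irrationality_exponent p target \<le> ereal \<mu>"
proof (rule irrationality_exponent_le)
  let ?c = "1 / ((2 * C) ^ 3 * real p ^ N 0)"
  show "min ?c (1 / real p) > 0" using C_ge_1 p_gt_1 by simp
  fix u v :: int assume uv: "u \<noteq> 0" "v \<noteq> 0"
  define H where "H = real_of_int (max \<bar>u\<bar> \<bar>v\<bar>)"
  have H: "H \<ge> 1" unfolding H_def using uv by (intro one_le_max_abs) auto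
  show "min ?c (1 / real p) * H powr (- \<mu>) \<le> padic_linear_form p target u v"
  proof (cases "\<exists>k. u * y k = v * x k")
    case True
    then obtain k where k: "u * y k = v * x k" by blast
    have "u \<noteq> 0 \<or> v \<noteq> 0" using uv by simp
    from linear_form_proportional[OF this k] obtain t where
      t: "t \<noteq> 0" "u = t * x k" "v = t * y k" and
      L: "1 / (real p * of_int \<bar>t\<bar>) * (real p ^ N k) powr (- \<mu>) \<le> padic_linear_form p target u v"
      by blast
    have "1 \<le> \<bar>t\<bar>" using t(1) by simp
    hence t1: "1 \<le> real_of_int \<bar>t\<bar>" by (metis of_int_1_le_iff)
    have "real_of_int \<bar>t\<bar> * real p ^ N k \<le> of_int \<bar>t\<bar> * of_int (x k)"
      using x_lower by (intro mult_left_mono) auto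
    also have "\<dots> \<le> H" unfolding H_def t(2) using x_pos[of k] by (simp add: abs_mult of_int_max)
    finally have "H powr (- \<mu>) \<le> (of_int \<bar>t\<bar> * real p ^ N k) powr (- \<mu>)"
      using t1 p_gt_1 \<mu>_ge_3 by (intro powr_mono2' mult_pos_pos) auto
    also have "\<dots> = of_int \<bar>t\<bar> powr (- \<mu>) * (real p ^ N k) powr (- \<mu>)"
      using t1 p_gt_1 by (intro powr_mult)
    \<comment> \<open>The multiplier raises the height by \<open>\<bar>t\<bar>\<close>; as
      \<open>\<mu>\<close> is at least 1, this outweighs the loss \<open>1 / \<bar>t\<bar>\<close>
      in the form.\<close>
    also have "\<dots> \<le> of_int \<bar>t\<bar> powr (- 1) * (real p ^ N k) powr (- \<mu>)"
      using t1 \<mu>_ge_3 by (intro mult_right_mono powr_mono) auto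
    also have "of_int \<bar>t\<bar> powr (- 1) = 1 / real_of_int \<bar>t\<bar>"
      using t1 by (simp add: powr_minus_divide)
    finally have "1 / real p * H powr (- \<mu>)
        \<le> 1 / real p * (1 / real_of_int \<bar>t\<bar> * (real p ^ N k) powr (- \<mu>))"
      by (intro mult_left_mono) auto
    also have "\<dots> \<le> padic_linear_form p target u v" using L by simp
    finally have "1 / real p * H powr (- \<mu>) \<le> padic_linear_form p target u v" .
    moreover have "min ?c (1 / real p) * H powr (- \<mu>) \<le> 1 / real p * H powr (- \<mu>)"
      by (intro mult_right_mono) auto
    ultimately show ?thesis by linarith
  next
    case False
    have "H powr (- \<mu>) \<le> H powr (- 3)" using H \<mu>_ge_3 by (intro powr_mono) auto
    also have "\<dots> = 1 / H ^ 3" using H by (simp add: powr_minus_divide)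
    finally have "?c * H powr (- \<mu>) \<le> ?c * (1 / H ^ 3)"
      using C_ge_1 by (intro mult_left_mono) auto
    also have "\<dots> \<le> padic_linear_form p target u v"
      using linear_form_not_proportional[of u v] False uv unfolding H_def by simp
    finally have "?c * H powr (- \<mu>) \<le> padic_linear_form p target u v" .
    moreover have "min ?c (1 / real p) * H powr (- \<mu>) \<le> ?c * H powr (- \<mu>)"
      by (intro mult_right_mono) auto
    ultimately show ?thesis by linarith
  qed
qed

lemma mult_irrationality_exponent_target_le: "mult_irrationality_exponent p target \<le> ereal \<mu>x"
proof (rule mult_irrationality_exponent_le)
  \<comment> \<open>The constant \<open>?c\<close> serves pairs not proportional to an approximant.
    In \<open>?d\<close>, for the multiples, \<open>1 / p\<close> comes from the rounding of
    \<open>N\<close> and the power of \<open>D\<close> from the lower bound on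
    \<open>y k\<close>.\<close>
  let ?c = "1 / ((2 * C) ^ 3 * real p ^ N 0)" and ?d = "1 / real p * D powr (- (\<mu>x / 2))"
  show "min ?c ?d > 0" using C_ge_1 p_gt_1 D_pos by simp
  fix u v :: int assume uv: "u \<noteq> 0" "v \<noteq> 0"
  define h where "h = sqrt (real_of_int \<bar>u * v\<bar>)"
  have h: "h \<ge> 1" unfolding h_def by (rule sqrt_abs_mult_bounds[OF uv])
  have h2: "h powr (- \<mu>x) = (h\<^sup>2) powr (- (\<mu>x / 2))"
  proof -
    have "h\<^sup>2 = h powr 2" using h by simp
    thus ?thesis by (simp only: powr_powr) simp
  qed
  have hsq: "h\<^sup>2 = real_of_int \<bar>u * v\<bar>" by (simp add: h_def)
  show "min ?c ?d * h powr (- \<mu>x) \<le> padic_linear_form p target u v"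
  proof (cases "\<exists>k. u * y k = v * x k")
    case True
    then obtain k where k: "u * y k = v * x k" by blast
    have "u \<noteq> 0 \<or> v \<noteq> 0" using uv by simp
    from linear_form_proportional[OF this k] obtain t where
      t: "t \<noteq> 0" "u = t * x k" "v = t * y k" and
      L: "1 / (real p * of_int \<bar>t\<bar>) * (real p ^ N k) powr (- \<mu>) \<le> padic_linear_form p target u v"
      by blast
    have "1 \<le> \<bar>t\<bar>" using t(1) by simp
    hence t1: "1 \<le> real_of_int \<bar>t\<bar>" by (metis of_int_1_le_iff)
    \<comment> \<open>Up to the factor \<open>D\<close>, \<open>Q\<close> bounds
      \<open>x k * y k\<close> from below, and its power \<open>- \<mu>x / 2\<close> is exactly
      \<open>p ^ N k\<close> to the power \<open>- \<mu>\<close>.\<close>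
    define Q where "Q = real p powr ((1 + a) * real (N k))"
    have Q: "Q > 0" using p_gt_1 by (simp add: Q_def)
    have "Q = real p ^ N k * real p powr (a * real (N k))"
      using p_gt_1 by (simp add: Q_def powr_add[symmetric] powr_realpow[symmetric] algebra_simps)
    also have "\<dots> \<le> of_int (x k) * (D * of_int (y k))"
      using x_lower[of k] y_lower[of k] x_pos[of k] by (intro mult_mono) auto
    finally have QD: "Q \<le> D * of_int (x k * y k)" by (simp add: ac_simps)
    have "of_int \<bar>t\<bar> * (of_int \<bar>t\<bar> * Q) \<le> of_int \<bar>t\<bar> * (of_int \<bar>t\<bar> * (D * of_int (x k * y k)))"
      using QD by (intro mult_left_mono) auto
    also have "\<dots> = D * h\<^sup>2"
      unfolding hsq t(2,3) using x_pos[of k] y_pos[of k] by (simp add: abs_mult ac_simps)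
    finally have tQ: "(of_int \<bar>t\<bar>)\<^sup>2 * Q \<le> D * h\<^sup>2" by (simp add: power2_eq_square)
    have "D powr (- (\<mu>x / 2)) * h powr (- \<mu>x) = (D * h\<^sup>2) powr (- (\<mu>x / 2))"
      unfolding h2 using D_pos h by (simp add: powr_mult)
    also have "\<dots> \<le> ((of_int \<bar>t\<bar>)\<^sup>2 * Q) powr (- (\<mu>x / 2))"
      using tQ Q t1 exponents by (intro powr_mono2' mult_pos_pos zero_less_power) auto
    also have "\<dots> = ((of_int \<bar>t\<bar>)\<^sup>2) powr (- (\<mu>x / 2)) * Q powr (- (\<mu>x / 2))"
      using Q by (intro powr_mult)
    also have "\<dots> \<le> of_int \<bar>t\<bar> powr (- 1) * Q powr (- (\<mu>x / 2))"
    proof (rule mult_right_mono)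
      have "(real_of_int \<bar>t\<bar>)\<^sup>2 = of_int \<bar>t\<bar> powr 2" using t1 by simp
      hence "((real_of_int \<bar>t\<bar>)\<^sup>2) powr (- (\<mu>x / 2)) = of_int \<bar>t\<bar> powr (- \<mu>x)"
        by (simp only: powr_powr) simp
      also have "\<dots> \<le> of_int \<bar>t\<bar> powr (- 1)" using t1 exponents by (intro powr_mono) auto
      finally show "((real_of_int \<bar>t\<bar>)\<^sup>2) powr (- (\<mu>x / 2)) \<le> of_int \<bar>t\<bar> powr (- 1)" .
    qed auto
    also have "of_int \<bar>t\<bar> powr (- 1) = 1 / real_of_int \<bar>t\<bar>"
      using t1 by (simp add: powr_minus_divide)
    also have "Q powr (- (\<mu>x / 2)) = (real p ^ N k) powr (- \<mu>)"
      unfolding Q_def exponents(1) powr_realpow[OF order.strict_trans[OF zero_less_one p_gt_1], symmetric]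
      by (simp add: powr_powr algebra_simps add_divide_distrib)
    finally have "1 / real p * (D powr (- (\<mu>x / 2)) * h powr (- \<mu>x))
        \<le> 1 / real p * (1 / real_of_int \<bar>t\<bar> * (real p ^ N k) powr (- \<mu>))"
      by (intro mult_left_mono) auto
    also have "\<dots> \<le> padic_linear_form p target u v" using L by simp
    finally have "?d * h powr (- \<mu>x) \<le> padic_linear_form p target u v" by simp
    moreover have "min ?c ?d * h powr (- \<mu>x) \<le> ?d * h powr (- \<mu>x)"
      by (intro mult_right_mono) auto
    ultimately show ?thesis by linarith
  next
    case False
    define H where "H = real_of_int (max \<bar>u\<bar> \<bar>v\<bar>)"
    have H: "H \<ge> 1" unfolding H_def using uv by (intro one_le_max_abs) auto
    \<comment> \<open>Passing from the product to the maximum halves the exponent;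
      \<open>\<mu>x \<ge> 6\<close> leaves at least the 3 that the nonproportional bound
      needs.\<close>
    have "(h\<^sup>2) powr (- (\<mu>x / 2)) \<le> H powr (- (\<mu>x / 2))"
      using sqrt_abs_mult_bounds(3)[OF uv] H exponents unfolding H_def h_def
      by (intro powr_mono2') auto
    also have "\<dots> \<le> H powr (- 3)" using H exponents by (intro powr_mono) auto
    also have "\<dots> = 1 / H ^ 3" using H by (simp add: powr_minus_divide)
    finally have "?c * h powr (- \<mu>x) \<le> ?c * (1 / H ^ 3)"
      unfolding h2 using C_ge_1 by (intro mult_left_mono) auto
    also have "\<dots> \<le> padic_linear_form p target u v"
      using linear_form_not_proportional[of u v] False uv unfolding H_def by simp
    finally have "?c * h powr (- \<mu>x) \<le> padic_linear_form p target u v" .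
    moreover have "min ?c ?d * h powr (- \<mu>x) \<le> ?c * h powr (- \<mu>x)"
      by (intro mult_right_mono) auto
    ultimately show ?thesis by linarith
  qed
qed

section \<open>Lower bounds for the two exponents\<close>

lemma linear_form_approximant_le:
  "padic_linear_form p target (x k) (y k) \<le> (real p powr real (N k)) powr (- \<mu>)"
proof -
  have "padic_linear_form p target (x k) (y k) = real p powr (- real (N (Suc k)))"
    using p_gt_1 by (simp add: linear_form_approximant powr_minus_divide powr_realpow)
  also have "\<dots> \<le> real p powr (- (\<mu> * real (N k)))"
    using N_lower[of k] p_gt_1 by (intro powr_mono) auto
  finally show ?thesis by (simp add: powr_powr mult.commute)
qed

lemma eventually_powr_N_ge:
  assumes "\<delta> > 0"
  shows "\<exists>K. \<forall>k\<ge>K. B \<le> (real p powr real (N k)) powr \<delta>"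
proof -
  obtain K where K: "B < (real p powr \<delta>) ^ K"
    using real_arch_pow[OF gr_one_powr[OF p_gt_1 assms]] by blast
  have "B \<le> (real p powr real (N k)) powr \<delta>" if "k \<ge> K" for k
  proof -
    have "(real p powr \<delta>) ^ K \<le> (real p powr \<delta>) ^ N k"
      using gr_one_powr[OF p_gt_1 assms] that N_ge[of k] by (intro power_increasing) auto
    also have "\<dots> = (real p powr real (N k)) powr \<delta>"
      using p_gt_1 by (simp add: powr_realpow[symmetric] powr_powr mult.commute)
    finally show ?thesis using K by linarith
  qed
  thus ?thesis by blast
qed

text \<open>One index makes the form smaller than \<open>e\<close> and lets the surplus power of
  \<open>p ^ N k\<close> beat the constant \<open>B\<close>. In the applications \<open>B\<close> is
  the power of \<open>C\<close> lost in the upper bound on the height.\<close>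

lemma approximant_small:
  assumes "e > 0" "\<delta> > 0"
  shows "\<exists>k. padic_linear_form p target (x k) (y k) < e \<and> B \<le> (real p powr real (N k)) powr \<delta>"
proof -
  obtain K where K: "\<And>k. k \<ge> K \<Longrightarrow> 1 / real p ^ N k < e" using inverse_power_N_small[OF assms(1)] by blast
  obtain K' where K': "\<And>k. k \<ge> K' \<Longrightarrow> B \<le> (real p powr real (N k)) powr \<delta>"
    using eventually_powr_N_ge[OF assms(2)] by blast
  show ?thesis
    using K[of "Suc (max K K')"] K'[of "max K K'"]
    by (intro exI[of _ "max K K'"]) (auto simp: linear_form_approximant)
qed

lemma irrationality_exponent_target_ge: "ereal \<mu> \<le> irrationality_exponent p target"
proof (rule irrationality_exponent_ge)
  show "0 < \<mu>" using \<mu>_ge_3 by simp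
  fix m e :: real assume m: "0 < m" "m < \<mu>" and e: "e > 0"
  have "\<mu> - m > 0" using m by simp
  from approximant_small[OF e this, of "C powr m"] obtain k where
    k: "padic_linear_form p target (x k) (y k) < e"
      "C powr m \<le> (real p powr real (N k)) powr (\<mu> - m)" by blast
  define P where "P = real p powr real (N k)"
  have P: "P > 0" "P = real p ^ N k" using p_gt_1 by (auto simp: P_def powr_realpow)
  have "1 * P \<le> C * P" using P by (intro mult_right_mono C_ge_1) auto
  hence "real_of_int (x k) \<le> C * P" "real_of_int (y k) \<le> C * P"
    using x_upper[of k] y_upper'[of k] unfolding P(2) by linarith+
  hence "real_of_int (max \<bar>x k\<bar> \<bar>y k\<bar>) \<le> C * P"
    using x_pos[of k] y_pos[of k] by (simp add: of_int_max)
  hence "(C * P) powr (- m) \<le> real_of_int (max \<bar>x k\<bar> \<bar>y k\<bar>) powr (- m)"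
    using m one_le_max_abs[of "x k" "y k"] x_pos[of k] by (intro powr_mono2') auto
  moreover have "P powr (- \<mu>) \<le> (C * P) powr (- m)"
  proof -
    have "P powr (- \<mu>) * C powr m \<le> P powr (- \<mu>) * P powr (\<mu> - m)"
      using k(2) unfolding P_def[symmetric] by (intro mult_left_mono) auto
    also have "\<dots> = P powr (- m)" by (simp add: powr_add[symmetric])
    finally have "P powr (- \<mu>) \<le> P powr (- m) / C powr m"
      using C_ge_1 by (subst pos_le_divide_eq) auto
    also have "\<dots> = C powr (- m) * P powr (- m)"
      by (simp add: powr_minus_divide)
    finally have "P powr (- \<mu>) \<le> C powr (- m) * P powr (- m)" .
    thus ?thesis using C_ge_1 P by (simp add: powr_mult)
  qed
  ultimately have "padic_linear_form p target (x k) (y k)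
      \<le> real_of_int (max \<bar>x k\<bar> \<bar>y k\<bar>) powr (- m)"
    using linear_form_approximant_le[of k] unfolding P_def[symmetric] by linarith
  hence "(x k, y k) \<in> approximations p target m"
    using linear_form_pos[of "x k" "y k"] x_pos[of k] y_pos[of k] by (simp add: approximations_def)
  thus "\<exists>(u, v) \<in> approximations p target m. padic_linear_form p target u v < e"
    using k(1) by (intro bexI[of _ "(x k, y k)"]) auto
qed

lemma mult_irrationality_exponent_target_ge: "ereal \<mu>x \<le> mult_irrationality_exponent p target"
proof (rule mult_irrationality_exponent_ge)
  show "0 < \<mu>x" using exponents by simp
  fix m e :: real assume m: "0 < m" "m < \<mu>x" and e: "e > 0"
  \<comment> \<open>Since \<open>x k * y k\<close> is at most \<open>C\<close> times
    \<open>p\<close> to the power \<open>(1 + a) * N k\<close>, the exponent \<open>m\<close>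
    requires only \<open>(1 + a) * m / 2\<close> of the available \<open>\<mu>\<close>;
    \<open>\<delta>\<close> is the surplus.\<close>
  define \<delta> where "\<delta> = (1 + a) * (\<mu>x - m) / 2"
  have "\<delta> > 0" using m a_range by (simp add: \<delta>_def)
  from approximant_small[OF e this, of "C powr (m / 2)"] obtain k where
    k: "padic_linear_form p target (x k) (y k) < e"
      "C powr (m / 2) \<le> (real p powr real (N k)) powr \<delta>" by blast
  define P where "P = real p powr real (N k)"
  have P: "P > 0" "P = real p ^ N k" using p_gt_1 by (auto simp: P_def powr_realpow)
  define h where "h = sqrt (real_of_int \<bar>x k * y k\<bar>)"
  have xy: "x k \<noteq> 0" "y k \<noteq> 0" using x_pos[of k] y_pos[of k] by auto
  have h: "h \<ge> 1" unfolding h_def by (rule sqrt_abs_mult_bounds[OF xy])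
  have "h\<^sup>2 = of_int (x k) * of_int (y k)"
    unfolding h_def using x_pos[of k] y_pos[of k] by (simp add: abs_mult)
  also have "\<dots> \<le> (C * P) * P powr a"
  proof (rule mult_mono)
    show "real_of_int (x k) \<le> C * P" using x_upper[of k] P by simp
    show "real_of_int (y k) \<le> P powr a"
      using y_upper[of k] by (simp add: P_def powr_powr mult.commute)
  qed (use C_ge_1 P y_pos[of k] in auto)
  also have "\<dots> = C * P powr (1 + a)" using P by (simp add: powr_add)
  finally have hsq: "h\<^sup>2 \<le> C * P powr (1 + a)" .
  have "h powr (- m) = (h powr 2) powr (- (m / 2))" by (simp only: powr_powr) simp
  also have "h powr 2 = h\<^sup>2" using h by simp
  finally have h2: "h powr (- m) = (h\<^sup>2) powr (- (m / 2))" .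
  have "P powr (- \<mu>) * C powr (m / 2) \<le> P powr (- \<mu>) * P powr \<delta>"
    using k(2) unfolding P_def[symmetric] by (intro mult_left_mono) auto
  also have "\<dots> = P powr ((1 + a) * (- (m / 2)))"
    unfolding exponents(1) \<delta>_def powr_add[symmetric]
    by (rule arg_cong[where f = "\<lambda>z. P powr z"]) (simp add: field_simps)
  finally have "P powr (- \<mu>) \<le> P powr ((1 + a) * (- (m / 2))) / C powr (m / 2)"
    using C_ge_1 by (subst pos_le_divide_eq) auto
  also have "\<dots> = C powr (- (m / 2)) * P powr ((1 + a) * (- (m / 2)))"
    by (simp add: powr_minus_divide)
  also have "\<dots> = (C * P powr (1 + a)) powr (- (m / 2))"
    using C_ge_1 P by (simp add: powr_mult powr_powr)
  also have "\<dots> \<le> h powr (- m)"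
    unfolding h2 using hsq h m by (intro powr_mono2') auto
  finally have "padic_linear_form p target (x k) (y k) \<le> h powr (- m)"
    using linear_form_approximant_le[of k] unfolding P_def[symmetric] by linarith
  hence "(x k, y k) \<in> mult_approximations p target m"
    using linear_form_pos[of "x k" "y k"] xy by (simp add: mult_approximations_def h_def)
  thus "\<exists>(u, v) \<in> mult_approximations p target m. padic_linear_form p target u v < e"
    using k(1) by (intro bexI[of _ "(x k, y k)"]) auto
qed

end

section \<open>Construction of the approximants and the final theorem\<close>

context padic_prime
begin

text \<open>Working modulo \<open>p ^ (n + 1)\<close> rather than \<open>p ^ n\<close> fixes the
  valuation of the determinant exactly: solving \<open>x' * y = x * y' + p ^ n\<close> there leaves
  the cofactor \<open>1 + p * t\<close>. The condition modulo \<open>q\<close> makes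
  \<open>x'\<close> prime to powers of \<open>q\<close>.\<close>

lemma prescribed_approximation_step:
  fixes q n :: nat and x y y' :: int
  assumes "coprime p q" "q > 0" "\<not> int p dvd y"
  shows "\<exists>x'. int p ^ n \<le> x' \<and> x' \<le> 2 * int p * int q * int p ^ n \<and> [x' = 1] (mod int q) \<and>
    (\<exists>w. x' * y - x * y' = int p ^ n * w \<and> \<not> int p dvd w)"
proof -
  have p0: "int p > 0" using prime_gt_0_nat[OF prime_p] by simp
  have "coprime y (int p ^ Suc n)"
    using prime_imp_coprime[OF prime_int_p assms(3)] by (simp add: coprime_commute)
  then obtain c where c: "[y * c = 1] (mod int p ^ Suc n)" using cong_solve_coprime_int by blast
  have "coprime (int p ^ Suc n) (int q)" using assms(1) by simp
  then obtain z where z: "[z = (x * y' + int p ^ n) * c] (mod int p ^ Suc n)" "[z = 1] (mod int q)"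
    using binary_chinese_remainder_int by blast
  define M where "M = int p ^ Suc n * int q"
  \<comment> \<open>Adding \<open>M\<close> places \<open>x'\<close> between \<open>M\<close> and
    \<open>2 * M\<close>, which supplies the lower bound that a plain residue could violate.\<close>
  define x' where "x' = z mod M + M"
  have M0: "M > 0" using p0 assms(2) by (simp add: M_def)
  have "[x' = z] (mod M)" by (simp add: x'_def cong_def)
  hence x'z: "[x' = z] (mod int p ^ Suc n)" "[x' = z] (mod int q)"
    unfolding M_def by (auto intro: cong_dvd_modulus)
  have "[x' * y = (x * y' + int p ^ n) * c * y] (mod int p ^ Suc n)"
    by (rule cong_scalar_right[OF cong_trans[OF x'z(1) z(1)]])
  also have "(x * y' + int p ^ n) * c * y = (x * y' + int p ^ n) * (y * c)" by simp
  also have "[(x * y' + int p ^ n) * (y * c) = (x * y' + int p ^ n) * 1] (mod int p ^ Suc n)"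
    by (rule cong_scalar_left[OF c])
  finally have "int p ^ Suc n dvd x' * y - (x * y' + int p ^ n)"
    by (simp add: cong_iff_dvd_diff)
  then obtain t where t: "x' * y - (x * y' + int p ^ n) = int p ^ Suc n * t" by (auto simp: dvd_def)
  have "\<not> int p dvd 1 + int p * t"
    using prime_int_p by (metis dvd_add_times_triv_right_iff not_prime_unit mult.commute)
  moreover have "x' * y - x * y' = int p ^ n * (1 + int p * t)"
    using t by (simp add: algebra_simps)
  moreover have "[x' = 1] (mod int q)" using x'z(2) z(2) by (rule cong_trans)
  moreover have "int p ^ n \<le> x'"
  proof -
    have "int p ^ n * 1 \<le> int p ^ n * (int p * int q)"
      using p0 assms(2) by (intro mult_left_mono) (auto simp: int_one_le_iff_zero_less)
    hence "int p ^ n \<le> M" by (simp add: M_def mult_ac)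
    thus ?thesis using pos_mod_sign[OF M0, of z] by (simp add: x'_def)
  qed
  moreover have "x' \<le> 2 * int p * int q * int p ^ n"
    using pos_mod_bound[OF M0, of z] by (simp add: x'_def M_def mult_ac)
  ultimately show ?thesis by blast
qed

text \<open>The least power of \<open>q\<close> exceeding \<open>z\<close> is not the zeroth one;
  its predecessor approximates \<open>z\<close> within a factor \<open>q\<close>, which becomes the
  constant \<open>D\<close>.\<close>

lemma power_bracket:
  fixes z :: real and q :: nat
  assumes "z \<ge> 1" "q > 1"
  shows "\<exists>e. real q ^ e \<le> z \<and> z \<le> real q * real q ^ e"
proof -
  obtain n where "z < real q ^ n" using real_arch_pow[of "real q" z] assms by auto
  then obtain n where n: "z < real q ^ n" "\<And>m. m < n \<Longrightarrow> \<not> z < real q ^ m"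
    using exists_least_iff[of "\<lambda>n. z < real q ^ n"] by blast
  obtain e where e: "n = Suc e" using n(1) assms(1) by (cases n) auto
  thus ?thesis using n(1) n(2)[of e] by (intro exI[of _ e]) auto
qed

lemma prescribed_approximations_exist:
  assumes "0 \<le> a" "a \<le> 1" "\<mu> = (1 + a) * \<mu>x / 2" "\<mu>x \<ge> 6"
  shows "\<exists>N x y C D. prescribed_approximations p N x y a C D \<mu> \<mu>x"
proof -
  have "(1 + a) * \<mu>x \<ge> 1 * 6" using assms by (intro mult_mono) auto
  hence \<mu>: "\<mu> \<ge> 3" using assms by simp
  define N :: "nat \<Rightarrow> nat" where "N = rec_nat 1 (\<lambda>_ n. nat \<lceil>\<mu> * real n\<rceil>)"
  have N0: "N 0 = 1" and N_Suc: "N (Suc k) = nat \<lceil>\<mu> * real (N k)\<rceil>" for k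
    by (simp_all add: N_def)
  have N_real: "real (N (Suc k)) = of_int \<lceil>\<mu> * real (N k)\<rceil>" for k
    unfolding N_Suc using \<mu> by simp
  have N_lower: "\<mu> * real (N k) \<le> real (N (Suc k))" for k unfolding N_real by simp
  have N_upper: "real (N (Suc k)) \<le> \<mu> * real (N k) + 1" for k unfolding N_real by linarith
  have N_double: "2 * N k \<le> N (Suc k)" for k
  proof -
    have "2 * real (N k) \<le> \<mu> * real (N k)" using \<mu> by (intro mult_right_mono) auto
    hence "real (2 * N k) \<le> real (N (Suc k))" using N_lower[of k] by simp
    thus ?thesis by (simp only: of_nat_le_iff)
  qed
  define q :: nat where "q = (if p = 2 then 3 else 2)"
  have q: "q > 1" "prime q" "p \<noteq> q" by (auto simp: q_def)
  hence cop: "coprime p q" using prime_p by (simp add: primes_coprime)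
  have "\<exists>e. real q ^ e \<le> real p powr (a * real (N k)) \<and> real p powr (a * real (N k)) \<le> real q * real q ^ e"
    for k
    using p_gt_1 assms(1) q(1) by (intro power_bracket ge_one_powr_ge_zero) auto
  then obtain e where e: "\<And>k. real q ^ e k \<le> real p powr (a * real (N k))"
      "\<And>k. real p powr (a * real (N k)) \<le> real q * real q ^ e k" by metis
  define y where "y k = int q ^ e k" for k
  have p_not_dvd_y: "\<not> int p dvd y k" for k
  proof
    assume "int p dvd y k"
    hence "int p dvd int q" unfolding y_def by (rule prime_dvd_power[OF prime_int_p])
    thus False using q prime_p by (simp add: primes_dvd_imp_eq)
  qed
  have coprime_y: "coprime x (y k)" if "[x = 1] (mod int q)" for x k
    using cong_imp_coprime[OF cong_sym[OF that]] by (simp add: y_def)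
  define C where "C = 2 * int p * int q"
  have C: "C \<ge> 1" using prime_gt_0_nat[OF prime_p] q(1) unfolding C_def
    by (simp add: int_one_le_iff_zero_less)
  have "\<exists>x. \<forall>k. (int p ^ N k \<le> x k \<and> x k \<le> C * int p ^ N k \<and> coprime (x k) (y k)) \<and>
      (\<exists>w. x (Suc k) * y k - x k * y (Suc k) = int p ^ N (Suc k) * w \<and> \<not> int p dvd w)"
  proof (rule dependent_nat_choice)
    \<comment> \<open>The recursion starts with \<open>x 0 = p ^ N 0\<close>, prime to every power
      of \<open>q\<close>.\<close>
    have "coprime (int p ^ N 0) (y 0)" using cop by (simp add: y_def)
    moreover have "1 * int p ^ N 0 \<le> C * int p ^ N 0" using C by (intro mult_right_mono) auto
    ultimately show "\<exists>x. int p ^ N 0 \<le> x \<and> x \<le> C * int p ^ N 0 \<and> coprime x (y 0)" by auto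
  next
    fix x k
    show "\<exists>x'. (int p ^ N (Suc k) \<le> x' \<and> x' \<le> C * int p ^ N (Suc k) \<and> coprime x' (y (Suc k))) \<and>
        (\<exists>w. x' * y k - x * y (Suc k) = int p ^ N (Suc k) * w \<and> \<not> int p dvd w)"
      using prescribed_approximation_step[OF cop _ p_not_dvd_y[of k], of "N (Suc k)" x "y (Suc k)"]
        q(1) coprime_y unfolding C_def by (metis zero_less_one less_trans)
  qed
  then obtain x where x: "\<And>k. int p ^ N k \<le> x k" "\<And>k. x k \<le> C * int p ^ N k"
      "\<And>k. coprime (x k) (y k)"
      "\<And>k. \<exists>w. x (Suc k) * y k - x k * y (Suc k) = int p ^ N (Suc k) * w \<and> \<not> int p dvd w"
    by blast
  have x_lower: "real p ^ N k \<le> of_int (x k)" for k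
  proof -
    have "real_of_int (int p ^ N k) \<le> of_int (x k)" using x(1)[of k] by (simp only: of_int_le_iff)
    thus ?thesis by simp
  qed
  have x_upper: "of_int (x k) \<le> of_int C * real p ^ N k" for k
  proof -
    have "real_of_int (x k) \<le> of_int (C * int p ^ N k)" using x(2)[of k] by (simp only: of_int_le_iff)
    thus ?thesis by simp
  qed
  have N0': "1 \<le> N 0" by (simp add: N0)
  have y_pos: "y k > 0" and y_upper: "of_int (y k) \<le> real p powr (a * real (N k))"
    and y_lower: "real p powr (a * real (N k)) \<le> real q * of_int (y k)" for k
    using q(1) e[of k] by (simp_all add: y_def)
  have "prescribed_approximations p N x y a (of_int C) (real q) \<mu> \<mu>x"
    by unfold_locales
      (fact N0' N_double N_lower N_upper x_lower x_upper y_pos y_lower y_upper x(3,4)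
        p_not_dvd_y assms)+
  thus ?thesis by blast
qed

lemma prescribed_exponents:
  assumes "6 \<le> \<mu>x" "\<mu>x / 2 \<le> \<mu>" "\<mu> \<le> \<mu>x"
  shows "\<exists>\<xi> \<in> padic_irrationals p. mult_irrationality_exponent p \<xi> = ereal \<mu>x \<and>
           irrationality_exponent p \<xi> = ereal \<mu>"
proof -
  \<comment> \<open>Solves \<open>\<mu> = (1 + a) * \<mu>x / 2\<close>; the condition that
    \<open>\<mu>\<close> lies between \<open>\<mu>x / 2\<close> and \<open>\<mu>x\<close> becomes
    that \<open>a\<close> lies between 0 and 1.\<close>
  define a where "a = 2 * \<mu> / \<mu>x - 1"
  have "0 \<le> a" "a \<le> 1" "\<mu> = (1 + a) * \<mu>x / 2"
    using assms by (simp_all add: a_def field_simps)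
  then obtain N x y C D where "prescribed_approximations p N x y a C D \<mu> \<mu>x"
    using prescribed_approximations_exist assms(1) by blast
  then interpret prescribed_approximations p N x y a C D \<mu> \<mu>x .
  show ?thesis
    by (intro bexI[of _ target] conjI target_irrational antisym
        mult_irrationality_exponent_target_le mult_irrationality_exponent_target_ge
        irrationality_exponent_target_le irrationality_exponent_target_ge)
qed

end

theorem theorem2p3:
  fixes p :: nat
  assumes "prime p"
  shows "(\<forall>\<mu> \<mu>x :: real. \<mu>x > 5 + sqrt 17 \<and> \<mu>x / 2 \<le> \<mu> \<and> \<mu> \<le> \<mu>x \<longrightarrow>
            (\<exists>\<xi> \<in> padic_irrationals p.
               mult_irrationality_exponent p \<xi> = ereal \<mu>x \<and>
               irrationality_exponent p \<xi> = ereal \<mu>)) \<and>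
         {mult_irrationality_exponent p \<xi> / irrationality_exponent p \<xi> | \<xi>.
            \<xi> \<in> padic_irrationals p \<and> irrationality_exponent p \<xi> < \<infinity>}
           = ereal ` {1..2}"
proof -
  interpret padic_prime p by unfold_locales (rule assms)
  \<comment> \<open>Gives \<open>5 + sqrt 17 \<ge> 6\<close>, the threshold in
    \<open>prescribed_exponents\<close>.\<close>
  have "sqrt 17 \<ge> 1" by (rule real_sqrt_ge_one) simp
  show ?thesis
  proof (intro conjI allI impI equalityI subsetI)
    fix \<mu> \<mu>x :: real
    assume *: "\<mu>x > 5 + sqrt 17 \<and> \<mu>x / 2 \<le> \<mu> \<and> \<mu> \<le> \<mu>x"
    hence "6 \<le> \<mu>x" using \<open>sqrt 17 \<ge> 1\<close> by linarith
    thus "\<exists>\<xi> \<in> padic_irrationals p. mult_irrationality_exponent p \<xi> = ereal \<mu>x \<and>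
        irrationality_exponent p \<xi> = ereal \<mu>"
      using * by (intro prescribed_exponents) auto
  next
    fix r assume "r \<in> ereal ` {1..2}"
    then obtain \<rho> where r: "r = ereal \<rho>" "1 \<le> \<rho>" "\<rho> \<le> 2" by auto
    \<comment> \<open>Every ratio \<open>\<rho>\<close> is realised with the fixed value
      \<open>\<mu>x = 6\<close> and \<open>\<mu> = 6 / \<rho>\<close>, which lies between 3 and
      6.\<close>
    hence "6 / 2 \<le> 6 / \<rho>" "6 / \<rho> \<le> 6" by (simp_all add: field_simps)
    then obtain \<xi> where "\<xi> \<in> padic_irrationals p" "mult_irrationality_exponent p \<xi> = ereal 6"
        "irrationality_exponent p \<xi> = ereal (6 / \<rho>)"
      using prescribed_exponents[of 6 "6 / \<rho>"] by auto
    thus "r \<in> {mult_irrationality_exponent p \<xi> / irrationality_exponent p \<xi> | \<xi>.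
            \<xi> \<in> padic_irrationals p \<and> irrationality_exponent p \<xi> < \<infinity>}"
      using r by (intro CollectI exI[of _ \<xi>]) auto
  qed (use exponent_ratio_range in blast)
qed

end
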